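(* For each $1\le j\le r$ and $m\ge0$, let $c_{j,(m),0},\dots,c_{j,(m),d-1}\in\mathbb{C}_\infty$ be the unique elements such that $\omega_j^{(m)}(\zeta_k)=\sum_{l=0}^{d-1}c_{j,(m),l}\,\zeta_k^{\,l}$ for all $k=1,\dots,d$. Then for every $n\ge 0$ the set \[ \{\, c_{j,(m),l}\ \mid\ 1\le j\le r,\ 0\le m\le n,\ 0\le l\le d-1\,\} \] is an $\mathbb{F}_q$-basis of $\phi[\mathfrak{p}^{n+1}]$.
   Context: Let $\mathbb{F}_q$ be a finite field with $q$ elements, $A=\mathbb{F}_q[\theta]$, $K=\mathbb{F}_q(\theta)$, $K_\infty=\mathbb{F}_q((1/\theta))$ with absolute value normalized by $|\theta|=q$, and $\mathbb{C}_\infty$ the completion of an algebraic closure of $K_\infty$. Let $F\subseteq \mathbb{C}_\infty$ be a field containing $K$. Let $\tau$ denote the $q$-Frobenius $x\mapsto x^q$, and let $\phi$ be a Drinfeld $A$-module of rank $r$ over $F$, given by $\phi_\theta=\theta+g_1\tau+\dots+g_r\tau^r$ with $g_i\in F$, $g_r\neq 0$. Let $\exp_\phi$ be its exponential function; its kernel $\Lambda_\phi$ is a free $A$-module of rank $r$; fix an $A$-basis $z_1,\dots,z_r$ of $\Lambda_\phi$. For $a\in A$ let $\phi[a]=\{x\in\mathbb{C}_\infty:\phi_a(x)=0\}$. Let $\mathbb{T}=\{\sum_{i\ge0}c_it^i: c_i\in\mathbb{C}_\infty,\ c_i\to0\}$ be the Tate algebra; its elements may be evaluated at $z\in\mathbb{C}_\infty$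 with $|z|\le 1$, written $h(z)$. For $h=\sum_i c_it^i\in\mathbb{T}$ and $n\ge0$, the $n$-th hyperderivative is $h^{(n)}=\sum_{i\ge n}\binom{i}{n}c_it^{i-n}$ (binomial coefficient taken mod $p$, the characteristic). The Anderson generating functions are $\omega_j=\sum_{i\ge0}\exp_\phi\!\left(z_j/\theta^{i+1}\right)t^i\in\mathbb{T}$, $j=1,\dots,r$. Let $\mathfrak{p}\in A$ be monic irreducible of degree $d$ and let $\zeta_1,\dots,\zeta_d\in\mathbb{C}_\infty$ be its roots (they lie in the algebraic closure of $\mathbb{F}_q$). For every $h\in\mathbb{T}$ there are unique $f_0,\dots,f_{d-1}\in\mathbb{C}_\infty$ with $h(\zeta_k)=\sum_{l=0}^{d-1}f_l\zeta_k^l$ for all $k=1,\dots,d$. *)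

theory Defs
  imports "HOL-Algebra.Algebraic_Closure_Type" "HOL-Analysis.Analysis"
begin

text \<open>
  The field \<open>K\<^sub>\<infinity> = \<bbbF>\<^sub>q((1/\<theta>))\<close> is the type of formal Laurent series over \<open>'k\<close> in the variable
  \<open>fls_X = 1/\<theta>\<close>, where \<open>q = CARD('k)\<close>. Thus \<open>\<theta>\<close> is \<open>fls_X_inv\<close> and
  \<open>\<bar>f\<bar> = q\<^bsup>-ord f\<^esup>\<close>, with \<open>ord\<close> the order in \<open>1/\<theta>\<close>.
\<close>

definition Kinf_abs :: "'k::finite_field fls \<Rightarrow> real" where
  "Kinf_abs f = (if f = 0 then 0 else real CARD('k) powi (- fls_subdegree f))"

text \<open>
  \<open>'c\<close> together with \<open>\<iota>\<close> is a completion of the algebraic closure of \<open>K\<^sub>\<infinity>\<close>: a complete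
  ultrametric valued field in which \<open>\<iota>\<close> embeds the algebraic closure as a dense subfield,
  the absolute value extending that of \<open>K\<^sub>\<infinity>\<close>. Completeness of the metric
  defined by \<open>av\<close> comes from the sort of \<open>'c\<close>.
\<close>

locale C_infinity =
  fixes \<iota> :: "'k::finite_field fls alg_closure \<Rightarrow> 'c::{field, complete_space}"
    and av :: "'c \<Rightarrow> real"
  assumes \<iota>_one: "\<iota> 1 = 1"
    and \<iota>_add: "\<iota> (x + y) = \<iota> x + \<iota> y"
    and \<iota>_mult: "\<iota> (x * y) = \<iota> x * \<iota> y"
    and dist_eq_av: "dist u v = av (u - v)"
    and av_mult: "av (u * v) = av u * av v"
    and av_ultrametric: "av (u + v) \<le> max (av u) (av v)"
    and av_\<iota>: "av (\<iota> (to_ac f)) = Kinf_abs f"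
    and dense: "closure (range \<iota>) = UNIV"

definition theta :: "('k::finite_field fls alg_closure \<Rightarrow> 'c::field) \<Rightarrow> 'c" where
  "theta \<iota> = \<iota> (to_ac fls_X_inv)"

definition embed_Fq :: "('k::finite_field fls alg_closure \<Rightarrow> 'c::field) \<Rightarrow> 'k \<Rightarrow> 'c" where
  "embed_Fq \<iota> a = \<iota> (to_ac (fls_const a))"

text \<open>
  \<open>A = \<bbbF>\<^sub>q[\<theta>]\<close> is the type \<open>'k poly\<close>; it is embedded into \<open>'c\<close> by evaluation at \<open>\<theta>\<close>.
\<close>

definition embed_A :: "('k::finite_field fls alg_closure \<Rightarrow> 'c::field) \<Rightarrow> 'k poly \<Rightarrow> 'c" where
  "embed_A \<iota> a = poly (map_poly (embed_Fq \<iota>) a) (theta \<iota>)"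

definition K_set :: "('k::finite_field fls alg_closure \<Rightarrow> 'c::field) \<Rightarrow> 'c set" where
  "K_set \<iota> = {embed_A \<iota> a / embed_A \<iota> b | a b. b \<noteq> 0}"

definition Fq_scale :: "('k::finite_field fls alg_closure \<Rightarrow> 'c::field) \<Rightarrow> 'k \<Rightarrow> 'c \<Rightarrow> 'c" where
  "Fq_scale \<iota> a x = embed_Fq \<iota> a * x"

definition A_scale :: "('k::finite_field fls alg_closure \<Rightarrow> 'c::field) \<Rightarrow> 'k poly \<Rightarrow> 'c \<Rightarrow> 'c" where
  "A_scale \<iota> a x = embed_A \<iota> a * x"

definition basis_family ::
    "('a::comm_ring_1 \<Rightarrow> 'b::ab_group_add \<Rightarrow> 'b) \<Rightarrow> 'i set \<Rightarrow> ('i \<Rightarrow> 'b) \<Rightarrow> 'b set \<Rightarrow> bool" where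
  "basis_family smul I b V \<longleftrightarrow>
     inj_on b I \<and> \<not> module.dependent smul (b ` I) \<and> module.span smul (b ` I) = V"

definition drinfeld_module :: "'c::field set \<Rightarrow> nat \<Rightarrow> (nat \<Rightarrow> 'c) \<Rightarrow> bool" where
  "drinfeld_module F r g \<longleftrightarrow> 1 \<le> r \<and> (\<forall>i\<in>{1..r}. g i \<in> F) \<and> g r \<noteq> 0"

definition phi_theta ::
    "('k::finite_field fls alg_closure \<Rightarrow> 'c::field) \<Rightarrow> nat \<Rightarrow> (nat \<Rightarrow> 'c) \<Rightarrow> 'c \<Rightarrow> 'c" where
  "phi_theta \<iota> r g x = theta \<iota> * x + (\<Sum>i=1..r. g i * x ^ (CARD('k) ^ i))"

text \<open>
  Multiplication of twisted polynomials is composition of operators, so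
  \<open>\<phi>\<^sub>a = \<Sum>\<^sub>i a\<^sub>i \<phi>\<^sub>\<theta>\<^sup>i\<close> with iterates of \<open>\<phi>\<^sub>\<theta>\<close> on the right.
\<close>

definition phi ::
    "('k::finite_field fls alg_closure \<Rightarrow> 'c::field) \<Rightarrow> nat \<Rightarrow> (nat \<Rightarrow> 'c) \<Rightarrow> 'k poly \<Rightarrow> 'c \<Rightarrow> 'c" where
  "phi \<iota> r g a x = (\<Sum>i\<le>degree a. embed_Fq \<iota> (poly.coeff a i) * (phi_theta \<iota> r g ^^ i) x)"

definition torsion ::
    "('k::finite_field fls alg_closure \<Rightarrow> 'c::field) \<Rightarrow> nat \<Rightarrow> (nat \<Rightarrow> 'c) \<Rightarrow> 'k poly \<Rightarrow> 'c set" where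
  "torsion \<iota> r g a = {x. phi \<iota> r g a x = 0}"

text \<open>
  The exponential is the twisted power series \<open>\<Sum>\<^sub>i e\<^sub>i \<tau>\<^sup>i\<close> with \<open>e\<^sub>0 = 1\<close> and
  \<open>exp\<^sub>\<phi> \<theta> = \<phi>\<^sub>\<theta> exp\<^sub>\<phi>\<close>. Comparing coefficients of \<open>\<tau>\<^sup>n\<close> gives
  \<open>e\<^sub>n \<theta>\<^bsup>q^n\<^esup> = \<theta> e\<^sub>n + \<Sum>\<^sub>i g\<^sub>i e\<^bsub>n-i\<^esub>\<^bsup>q^i\<^esup>\<close>, which is solved for \<open>e\<^sub>n\<close> here; see the
  uniqueness lemma \<open>exp_coeff_unique\<close> below.
\<close>

fun exp_coeff ::
    "('k::finite_field fls alg_closure \<Rightarrow> 'c::field) \<Rightarrow> nat \<Rightarrow> (nat \<Rightarrow> 'c) \<Rightarrow> nat \<Rightarrow> 'c" where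
  "exp_coeff \<iota> r g n =
     (if n = 0 then 1
      else (\<Sum>i\<in>{1..min r n}. g i * exp_coeff \<iota> r g (n - i) ^ (CARD('k) ^ i))
           / (theta \<iota> ^ (CARD('k) ^ n) - theta \<iota>))"

declare exp_coeff.simps [simp del]

definition drinfeld_exp ::
    "('k::finite_field fls alg_closure \<Rightarrow> 'c::{field, topological_space}) \<Rightarrow> nat \<Rightarrow> (nat \<Rightarrow> 'c)
      \<Rightarrow> 'c \<Rightarrow> 'c" where
  "drinfeld_exp \<iota> r g x = (\<Sum>i. exp_coeff \<iota> r g i * x ^ (CARD('k) ^ i))"

definition period_lattice ::
    "('k::finite_field fls alg_closure \<Rightarrow> 'c::{field, topological_space}) \<Rightarrow> nat \<Rightarrow> (nat \<Rightarrow> 'c)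
      \<Rightarrow> 'c set" where
  "period_lattice \<iota> r g = {x. drinfeld_exp \<iota> r g x = 0}"

text \<open>
  Elements of the Tate algebra are formal power series in \<open>t\<close> whose coefficients tend to \<open>0\<close>.
  The sum in \<open>tate_eval\<close> converges for such series at \<open>x\<close> with \<open>\<bar>x\<bar> \<le> 1\<close>.
\<close>

definition tate_eval :: "'c::{field, topological_space} fps \<Rightarrow> 'c \<Rightarrow> 'c" where
  "tate_eval h x = (\<Sum>i. fps_nth h i * x ^ i)"

definition hyperderiv :: "nat \<Rightarrow> 'c::field fps \<Rightarrow> 'c fps" where
  "hyperderiv n h = Abs_fps (\<lambda>i. of_nat ((i + n) choose n) * fps_nth h (i + n))"

definition anderson_gen ::
    "('k::finite_field fls alg_closure \<Rightarrow> 'c::{field, topological_space}) \<Rightarrow> nat \<Rightarrow> (nat \<Rightarrow> 'c)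
      \<Rightarrow> 'c \<Rightarrow> 'c fps" where
  "anderson_gen \<iota> r g z = Abs_fps (\<lambda>i. drinfeld_exp \<iota> r g (z / theta \<iota> ^ (i + 1)))"

context C_infinity
begin

lemma \<iota>_zero: "\<iota> 0 = 0"
  using \<iota>_add[of 0 0] unfolding add_0_right by (metis add_cancel_right_right)

lemma embed_Fq_hom:
  "embed_Fq \<iota> 0 = 0" "embed_Fq \<iota> 1 = 1"
  "embed_Fq \<iota> (a + b) = embed_Fq \<iota> a + embed_Fq \<iota> b"
  "embed_Fq \<iota> (a * b) = embed_Fq \<iota> a * embed_Fq \<iota> b"
proof -
  show "embed_Fq \<iota> 0 = 0" "embed_Fq \<iota> 1 = 1"
    by (simp_all add: embed_Fq_def \<iota>_zero \<iota>_one)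
  show "embed_Fq \<iota> (a + b) = embed_Fq \<iota> a + embed_Fq \<iota> b"
    unfolding embed_Fq_def fls_plus_const[symmetric] to_ac_add \<iota>_add ..
  show "embed_Fq \<iota> (a * b) = embed_Fq \<iota> a * embed_Fq \<iota> b"
    unfolding embed_Fq_def fls_const_mult_const[symmetric] to_ac_mult \<iota>_mult ..
qed

lemma embed_A_hom:
  "embed_A \<iota> 1 = 1"
  "embed_A \<iota> (a + b) = embed_A \<iota> a + embed_A \<iota> b"
  "embed_A \<iota> (a * b) = embed_A \<iota> a * embed_A \<iota> b"
proof -
  have add: "embed_A \<iota> (a + b) = embed_A \<iota> a + embed_A \<iota> b" for a b
  proof -
    have "map_poly (embed_Fq \<iota>) (a + b) = map_poly (embed_Fq \<iota>) a + map_poly (embed_Fq \<iota>) b"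
      by (rule poly_eqI) (simp add: coeff_map_poly embed_Fq_hom)
    then show ?thesis by (simp add: embed_A_def)
  qed
  have smult: "embed_A \<iota> (smult c a) = embed_Fq \<iota> c * embed_A \<iota> a" for c a
  proof -
    have "map_poly (embed_Fq \<iota>) (smult c a) = smult (embed_Fq \<iota> c) (map_poly (embed_Fq \<iota>) a)"
      by (rule poly_eqI) (simp add: coeff_map_poly embed_Fq_hom)
    then show ?thesis by (simp add: embed_A_def)
  qed
  have shift: "embed_A \<iota> (pCons 0 a) = theta \<iota> * embed_A \<iota> a" for a
    by (simp add: embed_A_def map_poly_pCons embed_Fq_hom)
  show "embed_A \<iota> 1 = 1"
    by (simp add: embed_A_def map_poly_1' embed_Fq_hom)
  show "embed_A \<iota> (a + b) = embed_A \<iota> a + embed_A \<iota> b" by (rule add)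
  show "embed_A \<iota> (a * b) = embed_A \<iota> a * embed_A \<iota> b"
  proof (induction a)
    case 0
    then show ?case by (simp add: embed_A_def)
  next
    case (pCons c a)
    have "embed_A \<iota> (pCons c a) = embed_Fq \<iota> c + theta \<iota> * embed_A \<iota> a"
      by (simp add: embed_A_def map_poly_pCons embed_Fq_hom)
    with pCons show ?case by (simp add: add smult shift algebra_simps)
  qed
qed

lemma vector_space_Fq_scale: "vector_space (Fq_scale \<iota>)"
  by unfold_locales (simp_all add: Fq_scale_def embed_Fq_hom algebra_simps)

lemma module_A_scale: "Modules.module (A_scale \<iota>)"
  by unfold_locales (simp_all add: A_scale_def embed_A_hom algebra_simps)

lemma av_theta: "av (theta \<iota>) = real CARD('k)"
  by (simp add: theta_def av_\<iota> Kinf_abs_def)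

lemma theta_power_neq:
  assumes "n > 0"
  shows "theta \<iota> ^ (CARD('k) ^ n) \<noteq> theta \<iota>"
proof
  assume eq: "theta \<iota> ^ (CARD('k) ^ n) = theta \<iota>"
  have one: "av (1 :: 'c) = 1"
    using av_\<iota>[of 1] by (simp add: \<iota>_one Kinf_abs_def)
  have pow: "av (x ^ m) = av x ^ m" for x :: 'c and m
    by (induction m) (simp_all add: one av_mult)
  have "card {0, 1 :: 'k} \<le> CARD('k)" by (rule card_mono) simp_all
  then have q: "CARD('k) > 1" by simp
  then have "CARD('k) ^ n > 1" using assms by (intro one_less_power)
  then have "real CARD('k) ^ 1 < real CARD('k) ^ (CARD('k) ^ n)"
    using q by (intro power_strict_increasing) simp_all
  moreover have "real CARD('k) ^ (CARD('k) ^ n) = real CARD('k)"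
    using arg_cong[OF eq, of av] by (simp add: pow av_theta)
  ultimately show False by simp
qed

lemma exp_coeff_unique:
  "(e 0 = 1 \<and> (\<forall>n. e n * theta \<iota> ^ (CARD('k) ^ n) =
       theta \<iota> * e n + (\<Sum>i=1..min r n. g i * e (n - i) ^ (CARD('k) ^ i))))
   \<longleftrightarrow> e = exp_coeff \<iota> r g"
  (is "?L e \<longleftrightarrow> _")
proof -
  have step: "e n * theta \<iota> ^ (CARD('k) ^ n) = theta \<iota> * e n + s \<longleftrightarrow>
      e n = s / (theta \<iota> ^ (CARD('k) ^ n) - theta \<iota>)" if "n > 0" for n s and e :: "nat \<Rightarrow> 'c"
    using theta_power_neq[OF that] by (auto simp: field_simps)
  have "?L (exp_coeff \<iota> r g)"
  proof (intro conjI allI)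
    show "exp_coeff \<iota> r g 0 = 1" by (simp add: exp_coeff.simps)
    fix n
    show "exp_coeff \<iota> r g n * theta \<iota> ^ (CARD('k) ^ n) = theta \<iota> * exp_coeff \<iota> r g n +
        (\<Sum>i=1..min r n. g i * exp_coeff \<iota> r g (n - i) ^ (CARD('k) ^ i))"
    proof (cases "n = 0")
      case True
      then show ?thesis by (simp add: exp_coeff.simps)
    next
      case False
      then show ?thesis by (subst step) (simp_all add: exp_coeff.simps[of _ _ _ n])
    qed
  qed
  moreover have "e n = exp_coeff \<iota> r g n" if L: "?L e" for n
  proof (induction n rule: less_induct)
    case (less n)
    show ?case
    proof (cases "n = 0")
      case True
      with L show ?thesis by (simp add: exp_coeff.simps)
    next
      case False
      have "(\<Sum>i=1..min r n. g i * e (n - i) ^ (CARD('k) ^ i)) =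
          (\<Sum>i=1..min r n. g i * exp_coeff \<iota> r g (n - i) ^ (CARD('k) ^ i))"
        using less False by (intro sum.cong) simp_all
      with False L step[of n e] show ?thesis
        by (simp add: exp_coeff.simps[of _ _ _ n])
    qed
  qed
  ultimately show ?thesis by (intro iffI ext) (blast, erule ssubst)
qed

end

end

theory Submission
  imports Defs
begin

text \<open>
  To a linear functional \<open>L\<close> on \<open>\<bbbF>\<^sub>q[X]\<close> attach the series \<open>\<beta>\<^sub>L = \<Sum>\<^sub>i L(X\<^sup>i) \<theta>\<^bsup>-i-1\<^esup>\<close> in \<open>K\<^sub>\<infinity>\<close>.
  By continuity and \<open>\<bbbF>\<^sub>q\<close>-linearity of the exponential, the coefficient of \<open>\<zeta>\<^sub>k\<^sup>l\<close> in
  \<open>\<omega>\<^sub>j\<^bsup>(m)\<^esup>(\<zeta>\<^sub>k)\<close> is \<open>exp\<^sub>\<phi>(z\<^sub>j \<beta>\<^sub>L)\<close>, where \<open>L\<close> sends \<open>f\<close> to the \<open>l\<close>-th coefficient of the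
  remainder of \<open>f\<^bsup>(m)\<^esup>\<close> modulo \<open>\<pp>\<close>.

  If functionals \<open>L\<^sub>j\<close> vanish on the ideal \<open>(P)\<close>, then \<open>P(\<theta>) \<beta>\<^bsub>L\<^sub>j\<^esub>\<close> lies in \<open>A\<close>, so
  \<open>exp\<^sub>\<phi>(\<Sum>\<^sub>j z\<^sub>j \<beta>\<^bsub>L\<^sub>j\<^esub>)\<close> is a \<open>P\<close>-torsion point. If this point is \<open>0\<close>, then \<open>\<Sum>\<^sub>j z\<^sub>j \<beta>\<^bsub>L\<^sub>j\<^esub>\<close> is a
  period, hence each \<open>\<beta>\<^bsub>L\<^sub>j\<^esub>\<close> lies in \<open>A\<close>; but \<open>\<beta>\<^sub>L\<close> has only negative powers of \<open>\<theta>\<close>, so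
  \<open>L\<^sub>j = 0\<close>. Thus a basis of the dual of \<open>A/P\<close> yields \<open>r deg P\<close> independent \<open>P\<close>-torsion
  points, and they form a basis because \<open>\<phi>\<^sub>P\<close> is a polynomial of degree \<open>q\<^bsup>r deg P\<^esup>\<close>.

  For \<open>P = \<pp>\<^bsup>n+1\<^esup>\<close> the functionals above form such a basis: testing a linear relation on multiples
  of \<open>\<pp>\<^sup>m\<close> isolates the \<open>m\<close>-th Hasse derivative, because \<open>\<pp>\<close> is separable.
\<close>

section \<open>Polynomials over finite fields\<close>

lemma CARD_gt_1: "1 < CARD('a::{finite, zero_neq_one})"
proof -
  have "card {0, 1 :: 'a} \<le> CARD('a)" by (rule card_mono) simp_all
  then show ?thesis by simp
qed

text \<open>
  The polynomial \<open>(X + 1)\<^sup>q - X\<^sup>q - 1\<close> has degree below \<open>q\<close> and vanishes at all \<open>q\<close> elements of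
  the field, hence it is zero.
\<close>

lemma of_nat_CARD_choose_eq_0:
  assumes "0 < i" "i < CARD('k)"
  shows "of_nat (CARD('k) choose i) = (0 :: 'k::finite_field)"
proof -
  let ?q = "CARD('k)"
  let ?f = "\<Sum>j\<in>{0<..<?q}. Polynomial.monom (of_nat (?q choose j) :: 'k) j"
  have "poly ?f x = 0" for x
  proof -
    have split: "{..?q} = insert 0 (insert ?q {0<..<?q})" by auto
    have "x + 1 = (x + 1) ^ ?q" by (simp add: finite_field_power_card_eq_same)
    also have "\<dots> = (\<Sum>j\<le>?q. of_nat (?q choose j) * x ^ j)"
      by (simp add: binomial_ring)
    also have "\<dots> = 1 + (x ^ ?q + (\<Sum>j\<in>{0<..<?q}. of_nat (?q choose j) * x ^ j))"
      unfolding split by (subst sum.insert; simp)+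
    also have "\<dots> = 1 + x + poly ?f x"
      by (simp add: finite_field_power_card_eq_same poly_sum poly_monom)
    finally show ?thesis by (simp add: algebra_simps)
  qed
  moreover have "degree ?f < ?q"
    by (intro degree_sum_less) (auto intro: le_less_trans[OF degree_monom_le])
  ultimately have "?f = 0"
    by (intro poly_eqI_degree[of UNIV]) auto
  moreover have "poly.coeff ?f i = of_nat (?q choose i)"
    using assms by (simp add: coeff_sum)
  ultimately show ?thesis by simp
qed

lemma of_nat_CARD_eq_0: "of_nat CARD('k) = (0 :: 'k::finite_field)"
  using of_nat_CARD_choose_eq_0[of 1, where ?'k = 'k] CARD_gt_1[where ?'a = 'k] by simp

lemma freshmans_dream_CARD:
  fixes x y :: "'a::comm_semiring_1"
  assumes "of_nat CHAR('k::finite_field) = (0 :: 'a)"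
  shows "(x + y) ^ CARD('k) = x ^ CARD('k) + y ^ CARD('k)"
proof -
  let ?q = "CARD('k)"
  have choose_0: "of_nat (?q choose i) = (0 :: 'a)" if "0 < i" "i < ?q" for i
  proof -
    have "CHAR('k) dvd ?q choose i"
      using of_nat_CARD_choose_eq_0[OF that] by (simp add: of_nat_eq_0_iff_char_dvd)
    then show ?thesis using assms by (auto elim!: dvdE)
  qed
  have "(x + y) ^ ?q = (\<Sum>i\<le>?q. of_nat (?q choose i) * x ^ i * y ^ (?q - i))"
    by (rule binomial_ring)
  also have "\<dots> = (\<Sum>i\<in>{0, ?q}. of_nat (?q choose i) * x ^ i * y ^ (?q - i))"
    by (rule sum.mono_neutral_right) (auto simp: choose_0)
  finally show ?thesis by (simp add: add.commute)
qed

lemma freshmans_dream_CARD_power: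
  fixes x y :: "'a::comm_semiring_1"
  assumes "of_nat CHAR('k::finite_field) = (0 :: 'a)"
  shows "(x + y) ^ (CARD('k) ^ n) = x ^ (CARD('k) ^ n) + y ^ (CARD('k) ^ n)"
  by (induction n arbitrary: x y)
     (simp_all add: freshmans_dream_CARD[OF assms] power_mult)

lemma finite_degree_less: "finite {f :: 'a::{zero, finite} poly. degree f < n}"
proof (rule finite_subset)
  show "{f :: 'a poly. degree f < n} \<subseteq> Poly ` {xs. set xs \<subseteq> UNIV \<and> length xs \<le> n}"
  proof
    fix f :: "'a poly"
    assume "f \<in> {f. degree f < n}"
    then have "length (coeffs f) \<le> n" by (cases "f = 0") (auto simp: length_coeffs_degree)
    then show "f \<in> Poly ` {xs. set xs \<subseteq> UNIV \<and> length xs \<le> n}"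
      by (intro image_eqI[of _ _ "coeffs f"]) auto
  qed
  show "finite (Poly ` {xs :: 'a list. set xs \<subseteq> UNIV \<and> length xs \<le> n})"
    by (intro finite_imageI finite_lists_length_le) simp
qed

lemma degree_mod_less_irreducible:
  fixes p :: "'a::field poly"
  assumes "irreducible p"
  shows "degree (f mod p) < degree p"
proof -
  have "p \<noteq> 0" "\<not> is_unit p" using assms by (auto simp: irreducible_def)
  then have "degree p > 0" by (simp add: is_unit_iff_degree)
  then show ?thesis using degree_mod_less[OF \<open>p \<noteq> 0\<close>, of f] by auto
qed

text \<open>
  Two of the residues of \<open>X, X\<^sup>q, X\<^bsup>q^2\<^esup>, \<dots>\<close> modulo \<open>p\<close> agree, and the difference of the
  corresponding powers is itself a power of some \<open>X\<^bsup>q^k\<^esup> - X\<close>.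
\<close>

lemma irreducible_dvd_X_power_CARD_minus_X:
  fixes p :: "'k::finite_field poly"
  assumes "irreducible p"
  obtains k where "k > 0" "p dvd Polynomial.monom 1 (CARD('k) ^ k) - Polynomial.monom 1 1"
proof -
  let ?q = "CARD('k)" and ?X = "\<lambda>n. Polynomial.monom 1 n :: 'k poly"
  have "finite (range (\<lambda>i. ?X (?q ^ i) mod p))"
    by (rule finite_subset[OF _ finite_degree_less[of "degree p"]])
       (auto intro: degree_mod_less_irreducible[OF assms])
  then have "\<not> inj (\<lambda>i. ?X (?q ^ i) mod p)" using finite_imageD by blast
  then obtain i j where "i < j" and residues: "?X (?q ^ j) mod p = ?X (?q ^ i) mod p"
    unfolding inj_def by (metis linorder_neqE_nat)
  have "of_nat CHAR('k) = (0 :: 'k poly)" by (metis of_nat_CHAR semiring_char_poly)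
  then have "(?X (?q ^ (j - i)) - ?X 1 + ?X 1) ^ (?q ^ i)
      = (?X (?q ^ (j - i)) - ?X 1) ^ (?q ^ i) + ?X 1 ^ (?q ^ i)"
    by (rule freshmans_dream_CARD_power)
  then have "?X (?q ^ j) - ?X (?q ^ i) = (?X (?q ^ (j - i)) - ?X 1) ^ (?q ^ i)"
    using \<open>i < j\<close> by (simp add: monom_power flip: power_add)
  moreover have "p dvd ?X (?q ^ j) - ?X (?q ^ i)"
    using residues by (simp add: mod_eq_dvd_iff)
  ultimately have "p dvd ?X (?q ^ (j - i)) - ?X 1"
    using prime_elem_dvd_power[OF field_poly_irreducible_imp_prime[OF assms]] by metis
  with \<open>i < j\<close> show ?thesis by (intro that[of "j - i"]) auto
qed

text \<open>Differentiate a factorisation \<open>X\<^bsup>q^k\<^esup> - X = p s\<close>: the left-hand side becomes \<open>-1\<close>.\<close>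

lemma irreducible_bezout_pderiv:
  fixes p :: "'k::finite_field poly"
  assumes "irreducible p"
  obtains u v where "u * p + v * pderiv p = 1"
proof -
  obtain k s where "k > 0"
    and s: "Polynomial.monom 1 (CARD('k) ^ k) - Polynomial.monom 1 1 = p * s"
    using irreducible_dvd_X_power_CARD_minus_X[OF assms] by (metis dvdE)
  have "of_nat (CARD('k) ^ k) = (0 :: 'k)" using \<open>k > 0\<close> by (simp add: of_nat_CARD_eq_0)
  then have "pderiv (p * s) = -1"
    by (simp add: pderiv_diff pderiv_monom monom_0 one_pCons flip: s del: of_nat_power)
  moreover have "(- pderiv s) * p + (- s) * pderiv p = - pderiv (p * s)"
    by (simp add: pderiv_mult algebra_simps)
  ultimately show ?thesis by (intro that[of "- pderiv s" "- s"]) simp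
qed

lemma inj_on_roots_if_pderiv_nonzero:
  fixes \<zeta> :: "'i \<Rightarrow> 'a::idom"
  assumes "finite I"
    and simple: "\<And>i. i \<in> I \<Longrightarrow> poly (pderiv (\<Prod>i\<in>I. [:- \<zeta> i, 1:])) (\<zeta> i) \<noteq> 0"
  shows "inj_on \<zeta> I"
proof (rule inj_onI, rule ccontr)
  fix i j assume ij: "i \<in> I" "j \<in> I" "\<zeta> i = \<zeta> j" "i \<noteq> j"
  let ?rest = "\<Prod>k\<in>I - {i} - {j}. [:- \<zeta> k, 1:]"
  have "(\<Prod>i\<in>I. [:- \<zeta> i, 1:]) = [:- \<zeta> i, 1:] * ([:- \<zeta> i, 1:] * ?rest)"
    using ij \<open>finite I\<close> prod.remove[of I i "\<lambda>k. [:- \<zeta> k, 1:]"]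
      prod.remove[of "I - {i}" j "\<lambda>k. [:- \<zeta> k, 1:]"] by simp
  then have "poly (pderiv (\<Prod>i\<in>I. [:- \<zeta> i, 1:])) (\<zeta> i) = 0"
    by (simp only: pderiv_mult) simp
  with simple[OF \<open>i \<in> I\<close>] show False ..
qed

lemma coeff_eq_if_power_sums_eq:
  fixes \<zeta> :: "'i \<Rightarrow> 'a::idom"
  assumes "inj_on \<zeta> I" "d \<le> card I"
    and eq: "\<And>i. i \<in> I \<Longrightarrow> (\<Sum>l<d. u l * \<zeta> i ^ l) = (\<Sum>l<d. v l * \<zeta> i ^ l)"
    and "l < d"
  shows "u l = v l"
proof -
  let ?poly = "\<lambda>w :: nat \<Rightarrow> 'a. \<Sum>l<d. Polynomial.monom (w l) l"
  have "degree (?poly w) < card (\<zeta> ` I)" for w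
    using \<open>l < d\<close> assms(1,2)
    by (intro degree_sum_less) (auto simp: card_image intro: le_less_trans[OF degree_monom_le])
  then have "?poly u = ?poly v"
    by (intro poly_eqI_degree[of "\<zeta> ` I"]) (auto simp: poly_sum poly_monom eq)
  then have "poly.coeff (?poly u) l = poly.coeff (?poly v) l" by simp
  with \<open>l < d\<close> show ?thesis by (simp add: coeff_sum)
qed

lemma map_poly_add:
  fixes f :: "'a::ab_group_add \<Rightarrow> 'b::ab_group_add"
  assumes "Modules.additive f"
  shows "map_poly f (p + q) = map_poly f p + map_poly f q"
proof -
  interpret Modules.additive f by fact
  show ?thesis by (rule poly_eqI) (simp add: coeff_map_poly zero add)
qed

lemma map_poly_mult:
  fixes f :: "'a::comm_ring_1 \<Rightarrow> 'b::comm_ring_1"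
  assumes "Modules.additive f" and mult: "\<And>x y. f (x * y) = f x * f y"
  shows "map_poly f (p * q) = map_poly f p * map_poly f q"
proof -
  interpret Modules.additive f by fact
  show ?thesis by (rule poly_eqI) (simp add: coeff_map_poly zero coeff_mult sum mult)
qed

section \<open>Hasse derivatives\<close>

text \<open>\<open>taylor f\<close> is \<open>f(X + u)\<close>, a polynomial in \<open>u\<close> whose coefficients are polynomials in \<open>X\<close>.\<close>

definition taylor :: "'a::comm_ring_1 poly \<Rightarrow> 'a poly poly" where
  "taylor f = map_poly (\<lambda>a. [:a:]) f \<circ>\<^sub>p [:[:0, 1:], 1:]"

definition hasse :: "nat \<Rightarrow> 'a::comm_ring_1 poly \<Rightarrow> 'a poly" where
  "hasse m f = poly.coeff (taylor f) m"

lemma additive_const_poly: "Modules.additive (\<lambda>a::'a::ab_group_add. [:a:])"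
  by unfold_locales simp

lemma taylor_add: "taylor (f + g) = taylor f + taylor g"
  by (simp add: taylor_def map_poly_add[OF additive_const_poly] pcompose_add)

lemma taylor_mult: "taylor (f * g) = taylor f * taylor g"
  by (simp add: taylor_def map_poly_mult[OF additive_const_poly] pcompose_mult)

lemma taylor_pCons: "taylor (pCons a f) = [:[:a:]:] + [:[:0, 1:], 1:] * taylor f"
  by (simp add: taylor_def map_poly_pCons pcompose_pCons)

lemma taylor_smult: "taylor (smult a f) = smult [:a:] (taylor f)"
  using taylor_mult[of "[:a:]" f] by (simp add: taylor_def map_poly_pCons)

lemma taylor_power: "taylor (f ^ n) = taylor f ^ n"
  by (induction n) (simp_all add: taylor_mult, simp add: taylor_def pcompose_1)

lemma hasse_add: "hasse m (f + g) = hasse m f + hasse m g"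
  by (simp add: hasse_def taylor_add)

lemma hasse_smult: "hasse m (smult a f) = smult a (hasse m f)"
  by (simp add: hasse_def taylor_smult)

lemma hasse_0: "hasse 0 f = f"
  by (induction f) (simp_all add: hasse_def taylor_pCons, simp add: taylor_def)

lemma hasse_1: "hasse (Suc 0) f = pderiv (f :: 'a::idom poly)"
proof (induction f)
  case (pCons a f)
  then show ?case using hasse_0[of f] by (simp add: hasse_def taylor_pCons pderiv_pCons)
qed (simp add: hasse_def taylor_def)

lemma hasse_monom:
  "hasse m (Polynomial.monom 1 n) = smult (of_nat (n choose m)) (Polynomial.monom 1 (n - m))"
proof -
  have taylor: "taylor (Polynomial.monom 1 n :: 'a poly) = [:[:0, 1:], 1:] ^ n"
    by (simp add: monom_altdef taylor_power)
       (simp add: taylor_def map_poly_pCons pcompose_pCons one_pCons)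
  show ?thesis
  proof (cases "m \<le> n")
    case True
    then show ?thesis
      by (simp add: hasse_def taylor coeff_linear_poly_power of_nat_poly) (simp add: monom_altdef)
  next
    case False
    have "degree ([:[:0, 1:], 1:] ^ n :: 'a poly poly) \<le> n"
      by (rule order_trans[OF degree_power_le]) simp
    with False show ?thesis
      by (simp add: hasse_def taylor coeff_eq_0 binomial_eq_0)
  qed
qed

text \<open>Modulo \<open>p\<close>, the Taylor expansion \<open>p + p' u + \<dots>\<close> of \<open>p\<close> is a multiple of \<open>u\<close>.\<close>

lemma taylor_power_mult_cong:
  fixes p h :: "'a::idom poly"
  obtains w where "[:p:] dvd taylor (p ^ m * h) - Polynomial.monom 1 m * w"
    and "poly.coeff w 0 = pderiv p ^ m * h"
proof -
  obtain v where v: "taylor p = pCons p v" using hasse_0[of p]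
    by (cases "taylor p") (simp add: hasse_def)
  have coeff_v: "poly.coeff v 0 = pderiv p" using hasse_1[of p] by (simp add: hasse_def v)
  let ?w = "v ^ m * taylor h"
  have shift: "pCons 0 v ^ m = Polynomial.monom 1 m * v ^ m"
    by (simp add: monom_altdef flip: power_mult_distrib)
  have "[:p:] = taylor p - pCons 0 v" by (simp add: v)
  then have "[:p:] dvd taylor p ^ m - pCons 0 v ^ m" by (simp add: power_diff_sumr2)
  then have "[:p:] dvd (taylor p ^ m - pCons 0 v ^ m) * taylor h" by (rule dvd_mult2)
  also have "(taylor p ^ m - pCons 0 v ^ m) * taylor h =
      taylor (p ^ m * h) - Polynomial.monom 1 m * ?w"
    unfolding taylor_mult taylor_power shift by (simp add: algebra_simps)
  finally show ?thesis
    using hasse_0[of h]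
    by (intro that[of ?w]) (simp_all add: coeff_mult_0 coeff_0_power coeff_v hasse_def)
qed

lemma dvd_hasse_power_mult:
  fixes p h :: "'a::idom poly"
  assumes "i < m"
  shows "p dvd hasse i (p ^ m * h)"
proof -
  obtain w where "[:p:] dvd taylor (p ^ m * h) - Polynomial.monom 1 m * w"
    by (rule taylor_power_mult_cong)
  then have "p dvd poly.coeff (taylor (p ^ m * h) - Polynomial.monom 1 m * w) i"
    unfolding const_poly_dvd_iff ..
  with assms show ?thesis by (simp add: hasse_def coeff_monom_mult)
qed

lemma hasse_power_mult_cong:
  fixes p h :: "'a::field poly"
  shows "hasse m (p ^ m * h) mod p = (pderiv p ^ m * h) mod p"
proof -
  obtain w where "[:p:] dvd taylor (p ^ m * h) - Polynomial.monom 1 m * w"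
    and w: "poly.coeff w 0 = pderiv p ^ m * h"
    by (rule taylor_power_mult_cong)
  then have "p dvd poly.coeff (taylor (p ^ m * h) - Polynomial.monom 1 m * w) m"
    unfolding const_poly_dvd_iff by blast
  then show ?thesis by (simp add: hasse_def coeff_monom_mult w mod_eq_dvd_iff)
qed

lemma exists_hasse_residues:
  fixes p :: "'k::finite_field poly"
  assumes "irreducible p"
  obtains f where "\<And>i. i < m \<Longrightarrow> hasse i f mod p = 0" "hasse m f mod p = g mod p"
proof -
  obtain u v where "u * p + v * pderiv p = 1" by (rule irreducible_bezout_pderiv[OF assms])
  then have "1 - pderiv p * v = p * u" by (simp add: algebra_simps)
  then have "p dvd 1 ^ m - (pderiv p * v) ^ m" unfolding power_diff_sumr2 by simp
  then have "p dvd (1 ^ m - (pderiv p * v) ^ m) * g" by (rule dvd_mult2)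
  then have "g mod p = (pderiv p ^ m * (v ^ m * g)) mod p"
    by (simp add: mod_eq_dvd_iff power_mult_distrib algebra_simps)
  then show ?thesis
    using dvd_hasse_power_mult[of _ m p "v ^ m * g"] hasse_power_mult_cong[of m p "v ^ m * g"]
    by (intro that[of "p ^ m * (v ^ m * g)"]) auto
qed

definition hasse_functional :: "'a::field poly \<Rightarrow> nat \<Rightarrow> nat \<Rightarrow> 'a poly \<Rightarrow> 'a" where
  "hasse_functional p m l f = poly.coeff (hasse m f mod p) l"

lemma hasse_functional_eq_0:
  assumes "p ^ Suc n dvd f" "m \<le> n"
  shows "hasse_functional p m l f = 0"
proof -
  obtain h where "f = p ^ Suc n * h" using assms(1) ..
  with dvd_hasse_power_mult[of m "Suc n" p h] assms(2) show ?thesis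
    by (simp add: hasse_functional_def del: power_Suc)
qed

lemma hasse_functionals_independent:
  fixes p :: "'k::finite_field poly"
  assumes "irreducible p"
    and vanish: "\<And>f. (\<Sum>(m, l)\<in>{..n} \<times> {..<degree p}. a m l * hasse_functional p m l f) = 0"
  shows "m \<le> n \<Longrightarrow> l < degree p \<Longrightarrow> a m l = 0"
proof (induction m arbitrary: l rule: nat_descend_induct[of n])
  case (descend m)
  obtain f where low: "\<And>i. i < m \<Longrightarrow> hasse i f mod p = 0"
    and top: "hasse m f mod p = Polynomial.monom 1 l mod p"
    using exists_hasse_residues[OF assms(1), of m "Polynomial.monom 1 l"] by blast
  have "Polynomial.monom 1 l mod p = Polynomial.monom 1 l"
    using \<open>l < degree p\<close> by (simp add: mod_poly_less degree_monom_eq)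
  then have terms: "(case ij of (i, j) \<Rightarrow> a i j * hasse_functional p i j f) =
      (if ij = (m, l) then a m l else 0)" if "ij \<in> {..n} \<times> {..<degree p}" for ij
    using that low[of "fst ij"] top descend.IH[of "fst ij" "snd ij"]
    by (cases "fst ij" m rule: linorder_cases) (auto simp: hasse_functional_def split_beta)
  have "0 = (\<Sum>(i, j)\<in>{..n} \<times> {..<degree p}. a i j * hasse_functional p i j f)"
    by (simp only: vanish)
  also have "\<dots> = (\<Sum>ij\<in>{..n} \<times> {..<degree p}. if ij = (m, l) then a m l else 0)"
    by (rule sum.cong[OF refl terms])
  also have "\<dots> = a m l" using descend.prems by simp
  finally show ?case by simp
qed simp

section \<open>Linear functionals and their generating series\<close>

abbreviation poly_functional :: "('a::comm_ring_1 poly \<Rightarrow> 'a) \<Rightarrow> bool" where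
  "poly_functional \<equiv> module_hom smult (*)"

lemma poly_functional_iff:
  "poly_functional L \<longleftrightarrow> (\<forall>f g. L (f + g) = L f + L g) \<and> (\<forall>a f. L (smult a f) = a * L f)"
proof -
  have "Modules.module (smult :: 'a \<Rightarrow> _)"
    by unfold_locales (simp_all add: smult_add_right smult_add_left)
  moreover have "Modules.module ((*) :: 'a \<Rightarrow> _)"
    by unfold_locales (simp_all add: algebra_simps)
  ultimately show ?thesis by (simp add: module_hom_iff)
qed

lemma poly_functional_lincomb:
  assumes "\<And>i. i \<in> A \<Longrightarrow> poly_functional (L i)"
  shows "poly_functional (\<lambda>f. \<Sum>i\<in>A. a i * L i f)"
proof -
  have "L i (f + h) = L i f + L i h" "L i (smult c f) = c * L i f" if "i \<in> A" for i f h c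
    using assms[OF that] by (auto simp: poly_functional_iff)
  then show ?thesis
    by (simp add: poly_functional_iff distrib_left sum.distrib sum_distrib_left mult.left_commute
        cong: sum.cong)
qed

lemma poly_functional_eq_0:
  assumes "poly_functional L" "\<And>n. L (Polynomial.monom 1 n) = 0"
  shows "L f = 0"
proof -
  interpret L: module_hom smult "(*)" L by fact
  have "L f = L (\<Sum>i\<le>degree f. smult (poly.coeff f i) (Polynomial.monom 1 i))"
    by (simp add: smult_monom poly_as_sum_of_monoms)
  also have "\<dots> = 0" by (simp add: L.sum L.scale assms(2))
  finally show ?thesis .
qed

lemma poly_functional_hasse: "poly_functional (hasse_functional p m l)"
  by (simp add: poly_functional_iff hasse_functional_def hasse_add hasse_smult
      poly_mod_add_left mod_smult_left)

text \<open>
  With \<open>\<theta> = 1/fls_X\<close> this is \<open>\<Sum>\<^sub>i L(X\<^sup>i) \<theta>\<^bsup>-i-1\<^esup>\<close>; for \<open>L\<close> the evaluation at \<open>x\<close> it would be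
  \<open>1/(\<theta> - x)\<close>.
\<close>

definition functional_fls :: "('a::comm_ring_1 poly \<Rightarrow> 'a) \<Rightarrow> 'a fls" where
  "functional_fls L = fls_X * fps_to_fls (Abs_fps (\<lambda>n. L (Polynomial.monom 1 n)))"

definition eval_X_inv :: "'a::comm_ring_1 poly \<Rightarrow> 'a fls" where
  "eval_X_inv f = poly (map_poly fls_const f) fls_X_inv"

lemma functional_fls_nth:
  "fls_nth (functional_fls L) n = (if n \<ge> 1 then L (Polynomial.monom 1 (nat (n - 1))) else 0)"
  by (simp add: functional_fls_def fls_X_times_conv_shift)

lemma functional_fls_lincomb:
  "functional_fls (\<lambda>f. \<Sum>i\<in>A. a i * L i f) = (\<Sum>i\<in>A. fls_const (a i) * functional_fls (L i))"
  by (rule fls_eqI) (simp add: functional_fls_nth fls_nth_sum)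

lemma X_inv_times_functional_fls:
  "fls_X_inv * functional_fls L = fls_const (L 1) + functional_fls (\<lambda>f. L (pCons 0 f))"
proof (rule fls_eqI)
  fix n :: int
  have "nat n = Suc (nat (n - 1))" if "n \<ge> 1" using that by simp
  then show "fls_nth (fls_X_inv * functional_fls L) n =
      fls_nth (fls_const (L 1) + functional_fls (\<lambda>f. L (pCons 0 f))) n"
    by (auto simp: fls_X_inv_times_conv_shift functional_fls_nth monom_0 one_pCons
        simp flip: monom_Suc)
qed

lemma eval_X_inv_0 [simp]: "eval_X_inv 0 = 0"
  by (simp add: eval_X_inv_def)

lemma eval_X_inv_pCons: "eval_X_inv (pCons a f) = fls_const a + fls_X_inv * eval_X_inv f"
  by (simp add: eval_X_inv_def map_poly_pCons)

lemma eval_X_inv_nth: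
  "fls_nth (eval_X_inv f) n = (if n \<le> 0 then poly.coeff f (nat (- n)) else 0)"
proof (induction f arbitrary: n)
  case (pCons a f)
  have "nat (- n) = Suc (nat (- (n + 1)))" if "n < 0" using that by simp
  then show ?case
    by (auto simp: eval_X_inv_pCons fls_X_inv_times_conv_shift pCons.IH coeff_pCons
        split: nat.splits)
qed simp

lemma eval_X_inv_eq_0_iff: "eval_X_inv f = 0 \<longleftrightarrow> f = 0"
proof
  assume "eval_X_inv f = 0"
  then have "fls_nth (eval_X_inv f) (- int i) = 0" for i by simp
  then show "f = 0" by (intro poly_eqI) (simp add: eval_X_inv_nth)
qed simp

lemma functional_eq_0_if_fls_polynomial:
  assumes "poly_functional L" "functional_fls L = eval_X_inv Q"
  shows "L f = 0"
proof (rule poly_functional_eq_0[OF assms(1)])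
  fix n
  have "fls_nth (functional_fls L) (int n + 1) = 0" unfolding assms(2) by (simp add: eval_X_inv_nth)
  then show "L (Polynomial.monom 1 n) = 0" by (simp add: functional_fls_nth)
qed

lemma eval_X_inv_times_functional_fls:
  assumes "poly_functional L"
  obtains Q where "eval_X_inv P * functional_fls L = eval_X_inv Q + functional_fls (\<lambda>f. L (P * f))"
proof -
  interpret L: module_hom smult "(*)" L by fact
  have "\<exists>Q. eval_X_inv P * functional_fls L = eval_X_inv Q + functional_fls (\<lambda>f. L (P * f))"
  proof (induction P)
    case 0
    have "functional_fls (\<lambda>f. L (0 * f)) = 0"
      by (rule fls_eqI) (simp add: functional_fls_nth L.zero)
    then show ?case by (intro exI[of _ 0]) simp
  next
    case (pCons a P)
    then obtain Q where Q: "eval_X_inv P * functional_fls L =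
        eval_X_inv Q + functional_fls (\<lambda>f. L (P * f))" by blast
    have "eval_X_inv (pCons a P) * functional_fls L =
        fls_const a * functional_fls L + fls_X_inv * (eval_X_inv P * functional_fls L)"
      by (simp add: eval_X_inv_pCons algebra_simps)
    also have "\<dots> = fls_X_inv * eval_X_inv Q +
        (fls_const a * functional_fls L + fls_X_inv * functional_fls (\<lambda>f. L (P * f)))"
      by (simp add: Q algebra_simps)
    also have "\<dots> = eval_X_inv (pCons (L P) Q) +
        (fls_const a * functional_fls L + functional_fls (\<lambda>f. L (P * pCons 0 f)))"
      by (simp add: X_inv_times_functional_fls eval_X_inv_pCons)
    also have "fls_const a * functional_fls L + functional_fls (\<lambda>f. L (P * pCons 0 f)) =
        functional_fls (\<lambda>f. L (pCons a P * f))"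
      by (rule fls_eqI) (simp add: functional_fls_nth L.add L.scale)
    finally show ?case by blast
  qed
  with that show ?thesis by blast
qed

lemma functional_fls_denominator:
  assumes "poly_functional L" "\<And>f. L (P * f) = 0"
  obtains Q where "eval_X_inv P * functional_fls L = eval_X_inv Q"
proof -
  have "functional_fls (\<lambda>f. L (P * f)) = 0"
    by (rule fls_eqI) (simp add: functional_fls_nth assms(2))
  then show ?thesis using eval_X_inv_times_functional_fls[OF assms(1), of P] that by auto
qed

section \<open>Bases as families\<close>

lemma (in vector_space) independent_familyI:
  assumes "finite I"
    and indep: "\<And>a i. (\<Sum>i\<in>I. scale (a i) (b i)) = 0 \<Longrightarrow> i \<in> I \<Longrightarrow> a i = 0"
  shows "inj_on b I" "independent (b ` I)"
proof -
  show inj: "inj_on b I"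
  proof (rule inj_onI, rule ccontr)
    fix i j assume ij: "i \<in> I" "j \<in> I" "b i = b j" "i \<noteq> j"
    let ?a = "\<lambda>k. (if k = i then 1 else 0) - (if k = j then 1 else 0)"
    have "(\<Sum>k\<in>I. scale (?a k) (b k)) =
        (\<Sum>k\<in>I. if k = i then b k else 0) - (\<Sum>k\<in>I. if k = j then b k else 0)"
      by (auto simp: scale_left_diff_distrib simp flip: sum_subtractf intro!: sum.cong)
    also have "\<dots> = 0" using ij \<open>finite I\<close> by simp
    finally show False using indep[of ?a i] ij by simp
  qed
  show "independent (b ` I)"
  proof (rule independent_if_scalars_zero)
    fix u x assume "(\<Sum>x\<in>b ` I. scale (u x) x) = 0" "x \<in> b ` I"
    then show "u x = 0" using indep[of "u \<circ> b"] by (auto simp: sum.reindex[OF inj])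
  qed (use \<open>finite I\<close> in simp)
qed

lemma (in vector_space) card_span_independent:
  assumes "finite (UNIV :: 'a set)" "finite B" "independent B"
  shows "card (span B) = CARD('a) ^ card B"
proof -
  let ?lincomb = "\<lambda>u. \<Sum>v\<in>B. scale (u v) v" and ?coeffs = "PiE B (\<lambda>_. UNIV :: 'a set)"
  have "inj_on ?lincomb ?coeffs"
  proof (rule inj_onI)
    fix u u' assume "u \<in> ?coeffs" "u' \<in> ?coeffs" "?lincomb u = ?lincomb u'"
    moreover from this have "(\<Sum>v\<in>B. scale (u v - u' v) v) = 0"
      by (simp add: scale_left_diff_distrib sum_subtractf)
    then have "u v - u' v = 0" if "v \<in> B" for v
      using that independentD[OF assms(3,2) order_refl, of "\<lambda>v. u v - u' v"] by blast
    ultimately show "u = u'" by (intro PiE_ext) auto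
  qed
  moreover have "?lincomb ` ?coeffs = span B"
    unfolding span_finite[OF assms(2)]
  proof (intro antisym subsetI)
    fix x assume "x \<in> range ?lincomb"
    then obtain u where "x = ?lincomb u" by blast
    then show "x \<in> ?lincomb ` ?coeffs" by (intro image_eqI[of _ _ "restrict u B"]) simp_all
  qed blast
  ultimately show ?thesis
    using card_image[of ?lincomb ?coeffs] assms(2) by (simp add: card_PiE)
qed

lemma basis_familyI_card:
  fixes smul :: "'k::finite_field \<Rightarrow> 'b::ab_group_add \<Rightarrow> 'b"
  assumes "vector_space smul" "finite I" "finite V" "card V \<le> CARD('k) ^ card I"
    and mem: "\<And>a. (\<Sum>i\<in>I. smul (a i) (b i)) \<in> V"
    and indep: "\<And>a i. (\<Sum>i\<in>I. smul (a i) (b i)) = 0 \<Longrightarrow> i \<in> I \<Longrightarrow> a i = 0"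
  shows "basis_family smul I b V"
proof -
  interpret vector_space smul by fact
  have family: "inj_on b I" "independent (b ` I)"
    by (rule independent_familyI[OF \<open>finite I\<close>], rule indep, assumption+)+
  have "card (span (b ` I)) = CARD('k) ^ card I"
    using card_span_independent[OF _ _ family(2)] \<open>finite I\<close> by (simp add: card_image family(1))
  moreover have "span (b ` I) \<subseteq> V"
    using mem \<open>finite I\<close> by (auto simp: span_finite sum.reindex[OF family(1)])
  ultimately have "span (b ` I) = V"
    using assms(3,4) by (intro card_seteq) simp_all
  with family show ?thesis by (simp add: basis_family_def)
qed

lemma basis_family_cong:
  assumes "\<And>i. i \<in> I \<Longrightarrow> b i = b' i"
  shows "basis_family smul I b V \<longleftrightarrow> basis_family smul I b' V"
  using assms by (simp add: basis_family_def cong: inj_on_cong image_cong)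

lemma basis_family_mem:
  assumes "Modules.module smul" "basis_family smul I b V" "i \<in> I"
  shows "b i \<in> V"
proof -
  interpret Modules.module smul by fact
  show ?thesis using assms(2,3) span_base[of "b i" "b ` I"] by (auto simp: basis_family_def)
qed

lemma basis_family_expand:
  assumes "Modules.module smul" "basis_family smul I b V" "finite I" "x \<in> V"
  obtains a where "x = (\<Sum>i\<in>I. smul (a i) (b i))"
proof -
  interpret Modules.module smul by fact
  have inj: "inj_on b I" and "x \<in> span (b ` I)"
    using assms(2,4) by (auto simp: basis_family_def)
  then obtain u where "x = (\<Sum>v\<in>b ` I. smul (u v) v)"
    using \<open>finite I\<close> by (auto simp: span_finite)
  then show ?thesis using that[of "u \<circ> b"] by (simp add: sum.reindex[OF inj])
qed

lemma basis_family_coeff_unique: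
  assumes "Modules.module smul" "basis_family smul I b V" "finite I"
    and eq: "(\<Sum>i\<in>I. smul (a i) (b i)) = (\<Sum>i\<in>I. smul (a' i) (b i))" and "i \<in> I"
  shows "a i = a' i"
proof -
  interpret Modules.module smul by fact
  have inj: "inj_on b I" and indep: "independent (b ` I)"
    using assms(2) by (auto simp: basis_family_def)
  let ?u = "\<lambda>v. a (inv_into I b v) - a' (inv_into I b v)"
  have "(\<Sum>v\<in>b ` I. smul (?u v) v) = 0"
    using eq by (simp add: sum.reindex[OF inj] inj scale_left_diff_distrib sum_subtractf)
  then have "?u (b i) = 0"
    using \<open>i \<in> I\<close> \<open>finite I\<close> by (intro independentD[OF indep, of "b ` I"]) auto
  then show ?thesis using inj \<open>i \<in> I\<close> by simp
qed

section \<open>Sequences and series\<close>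

text \<open>Generalises \<open>sums_zero_iff_shift\<close>, which is stated for real normed vector spaces.\<close>

lemma sums_shift_iff_if_zero:
  fixes f :: "nat \<Rightarrow> 'a::{comm_monoid_add, topological_space}"
  assumes "\<And>i. i < n \<Longrightarrow> f i = 0"
  shows "(\<lambda>i. f (i + n)) sums s \<longleftrightarrow> f sums s"
proof -
  have "(\<Sum>i<k. f (i + n)) = sum f {..<k + n}" for k
    by (induction k) (simp_all add: assms)
  then show ?thesis
    unfolding sums_def
    using LIMSEQ_ignore_initial_segment[of "\<lambda>k. sum f {..<k}" s n]
      LIMSEQ_offset[of "\<lambda>k. sum f {..<k}" n s] by auto
qed

lemma geometric_bound_if_contracting_recurrence:
  fixes a :: "nat \<Rightarrow> real"
  assumes nonneg: "\<And>n. 0 \<le> a n" and "0 < c" "c < 1"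
    and contracting:
      "\<forall>\<^sub>F n in sequentially. a n = 0 \<or> (\<exists>i\<in>{1..min r n}. a n \<le> c * a (n - i))"
  obtains D s where "0 < s" "s < 1" "\<And>n. a n \<le> D * s ^ n"
proof -
  obtain N where N: "a n = 0 \<or> (\<exists>i\<in>{1..min r n}. a n \<le> c * a (n - i))" if "n \<ge> N" for n
    using contracting unfolding eventually_sequentially by blast
  define s where "s = root (Suc r) c"
  have s: "0 < s" "s < 1" "s ^ Suc r = c"
    using \<open>0 < c\<close> \<open>c < 1\<close> by (simp_all add: s_def del: power_Suc)
  have c_le: "c \<le> s ^ i" if "i \<le> r" for i
    using s that unfolding s(3)[symmetric] by (intro power_decreasing) auto
  define D where "D = (\<Sum>n\<le>N. a n / s ^ n)"
  have "0 \<le> D" unfolding D_def using s nonneg by (intro sum_nonneg) simp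
  have "a n \<le> D * s ^ n" for n
  proof (induction n rule: less_induct)
    case (less n)
    consider (initial) "n \<le> N" | (zero) "a n = 0"
      | (step) i where "i \<in> {1..min r n}" "a n \<le> c * a (n - i)"
      using N[of n] by (meson nat_le_linear)
    then show ?case
    proof cases
      case initial
      then have "a n / s ^ n \<le> D"
        unfolding D_def using s nonneg by (intro member_le_sum) simp_all
      then show ?thesis using s by (simp add: field_simps)
    next
      case zero
      then show ?thesis using \<open>0 \<le> D\<close> s by simp
    next
      case step
      have "a n \<le> s ^ i * (D * s ^ (n - i))"
        using step s nonneg by (intro order_trans[OF step(2)] mult_mono c_le less) auto
      also have "\<dots> = D * s ^ n" using step(1) by (simp flip: power_add)
      finally show ?thesis .
    qed
  qed
  with s(1,2) show ?thesis by (rule that)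
qed

lemma tendsto_0_if_contracting_recurrence:
  fixes a :: "nat \<Rightarrow> real"
  assumes "\<And>n. 0 \<le> a n" and "0 < c" "c < 1"
    and "\<forall>\<^sub>F n in sequentially. a n = 0 \<or> (\<exists>i\<in>{1..min r n}. a n \<le> c * a (n - i))"
  shows "a \<longlonglongrightarrow> 0"
proof -
  obtain D s where "0 < s" "s < 1" and geometric: "\<And>n. a n \<le> D * s ^ n"
    using geometric_bound_if_contracting_recurrence[OF assms] by blast
  then have "(\<lambda>n. D * s ^ n) \<longlonglongrightarrow> 0"
    by (intro tendsto_mult_right_zero LIMSEQ_realpow_zero) auto
  then show ?thesis
    by (rule Lim_null_comparison[rotated]) (simp add: geometric assms(1))
qed

section \<open>Complete ultrametric fields\<close>

locale complete_ultrametric_field =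
  fixes av :: "'c::{field, complete_space} \<Rightarrow> real"
  assumes dist_eq_av: "dist u v = av (u - v)"
    and av_mult: "av (u * v) = av u * av v"
    and av_ultrametric: "av (u + v) \<le> max (av u) (av v)"
begin

lemma av_eq_dist: "av u = dist u 0"
  by (simp add: dist_eq_av)

lemma av_0 [simp]: "av 0 = 0"
  by (simp add: av_eq_dist)

lemma av_nonneg [simp]: "0 \<le> av u"
  by (simp add: av_eq_dist)

lemma av_eq_0_iff [simp]: "av u = 0 \<longleftrightarrow> u = 0"
  by (simp add: av_eq_dist)

lemma av_1 [simp]: "av 1 = 1"
  using av_mult[of 1 1] av_eq_0_iff[of 1] by simp

lemma av_power: "av (x ^ n) = av x ^ n"
  by (induction n) (simp_all add: av_mult)

lemma av_divide: "av (x / y) = av x / av y"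
proof (cases "y = 0")
  case False
  then have "av x = av (x / y) * av y" by (simp flip: av_mult)
  with False show ?thesis by (simp add: field_simps)
qed simp

lemma av_minus_commute: "av (x - y) = av (y - x)"
  using dist_commute[of x y] by (simp only: dist_eq_av)

lemma av_sum_attained:
  assumes "finite A" "A \<noteq> {}"
  obtains i where "i \<in> A" "av (sum f A) \<le> av (f i)"
proof -
  have "\<exists>i\<in>A. av (sum f A) \<le> av (f i)"
    using assms
  proof (induction A rule: finite_ne_induct)
    case (insert j A)
    then show ?case
      using av_ultrametric[of "f j" "sum f A"] by (fastforce simp: max_def split: if_splits)
  qed simp
  with that show ?thesis by blast
qed

lemma av_sum_le:
  assumes "0 \<le> B" "\<And>i. i \<in> A \<Longrightarrow> av (f i) \<le> B"
  shows "av (sum f A) \<le> B"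
proof (cases "finite A \<and> A \<noteq> {}")
  case True
  then show ?thesis using assms(2) av_sum_attained[of A f] order_trans by metis
qed (use assms(1) in auto)

lemma tendsto_av_iff: "(U \<longlongrightarrow> l) F \<longleftrightarrow> ((\<lambda>n. av (U n - l)) \<longlongrightarrow> 0) F"
  by (subst tendsto_dist_iff) (simp add: dist_eq_av)

lemma tendsto_av_add:
  fixes U V :: "'b \<Rightarrow> 'c"
  assumes "(U \<longlongrightarrow> a) F" "(V \<longlongrightarrow> b) F"
  shows "((\<lambda>n. U n + V n) \<longlongrightarrow> a + b) F"
  unfolding tendsto_av_iff
proof (rule Lim_null_comparison)
  have "av (U n + V n - (a + b)) \<le> av (U n - a) + av (V n - b)" for n
    using av_ultrametric[of "U n - a" "V n - b"] av_nonneg[of "U n - a"] av_nonneg[of "V n - b"]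
    unfolding add_diff_add by linarith
  then show "\<forall>\<^sub>F n in F. norm (av (U n + V n - (a + b))) \<le> av (U n - a) + av (V n - b)"
    by simp
  show "((\<lambda>n. av (U n - a) + av (V n - b)) \<longlongrightarrow> 0) F"
    using assms unfolding tendsto_av_iff[of U] tendsto_av_iff[of V] by (rule tendsto_add_zero)
qed

lemma tendsto_av_mult_left:
  fixes U :: "'b \<Rightarrow> 'c"
  assumes "(U \<longlongrightarrow> a) F"
  shows "((\<lambda>n. c * U n) \<longlongrightarrow> c * a) F"
  using assms unfolding tendsto_av_iff
  by (auto simp: av_mult simp flip: right_diff_distrib intro: tendsto_mult_right_zero)

lemma sums_av_add: "f sums a \<Longrightarrow> h sums b \<Longrightarrow> (\<lambda>n. f n + h n :: 'c) sums (a + b)"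
  unfolding sums_def sum.distrib by (rule tendsto_av_add)

lemma sums_av_mult_left: "f sums a \<Longrightarrow> (\<lambda>n. c * f n :: 'c) sums (c * a)"
  unfolding sums_def sum_distrib_left[symmetric] by (rule tendsto_av_mult_left)

lemma sums_av_sum:
  assumes "\<And>i. i \<in> A \<Longrightarrow> f i sums a i"
  shows "(\<lambda>n. \<Sum>i\<in>A. f i n :: 'c) sums (\<Sum>i\<in>A. a i)"
  using assms by (induction A rule: infinite_finite_induct) (auto intro: sums_av_add)

lemma av_sums_le:
  assumes "f sums s" "\<And>n. av (f n) \<le> B"
  shows "av s \<le> B"
proof -
  have "0 \<le> B" using assms(2)[of 0] av_nonneg[of "f 0"] by linarith
  have "(\<lambda>n. dist (sum f {..<n}) 0) \<longlonglongrightarrow> dist s 0"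
    using assms(1) unfolding sums_def by (intro tendsto_intros)
  then show ?thesis
    unfolding av_eq_dist
    by (rule LIMSEQ_le_const2)
       (use assms(2) \<open>0 \<le> B\<close> in \<open>auto simp flip: av_eq_dist intro: av_sum_le\<close>)
qed

lemma summable_av:
  assumes "(\<lambda>n. av (f n)) \<longlonglongrightarrow> 0"
  shows "summable f"
proof -
  have "Cauchy (\<lambda>n. sum f {..<n})"
  proof (rule metric_CauchyI)
    fix e :: real assume "e > 0"
    then have "\<forall>\<^sub>F n in sequentially. av (f n) < e / 2" using assms by (intro order_tendstoD) auto
    then obtain N where N: "av (f n) \<le> e / 2" if "n \<ge> N" for n
      unfolding eventually_sequentially by (meson less_imp_le)
    have ordered: "dist (sum f {..<m}) (sum f {..<n}) \<le> e / 2" if "N \<le> m" "m \<le> n" for m n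
    proof -
      have "sum f {..<n} - sum f {..<m} = sum f ({..<n} - {..<m})"
        using that by (subst sum_diff) auto
      also have "av \<dots> \<le> e / 2"
        using \<open>e > 0\<close> that by (intro av_sum_le N) auto
      finally show ?thesis by (subst dist_commute) (simp add: dist_eq_av)
    qed
    have "dist (sum f {..<m}) (sum f {..<n}) < e" if "N \<le> m" "N \<le> n" for m n
    proof -
      have "dist (sum f {..<m}) (sum f {..<n}) \<le> e / 2"
        using ordered[of m n] ordered[of n m] that by (metis dist_commute nat_le_linear)
      then show ?thesis using \<open>e > 0\<close> by simp
    qed
    then show "\<exists>M. \<forall>m\<ge>M. \<forall>n\<ge>M. dist (sum f {..<m}) (sum f {..<n}) < e" by blast
  qed
  then show ?thesis
    using Cauchy_convergent by (auto simp: convergent_def summable_def sums_def)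
qed

end

context C_infinity
begin

section \<open>Constants, Laurent series and Frobenius\<close>

sublocale complete_ultrametric_field av
  by unfold_locales (fact dist_eq_av av_mult av_ultrametric)+

abbreviation embed_Kinf :: "'k fls \<Rightarrow> 'c" where
  "embed_Kinf f \<equiv> \<iota> (to_ac f)"

sublocale embed_Kinf: Modules.additive embed_Kinf
  by unfold_locales (simp only: to_ac_add \<iota>_add)

sublocale embed_Fq: Modules.additive "embed_Fq \<iota>"
  by unfold_locales (rule embed_Fq_hom)

sublocale embed_A: Modules.additive "embed_A \<iota>"
  by unfold_locales (rule embed_A_hom)

lemma embed_Kinf_mult: "embed_Kinf (f * h) = embed_Kinf f * embed_Kinf h"
  by (simp only: to_ac_mult \<iota>_mult)

lemma embed_Kinf_eq_0_iff: "embed_Kinf f = 0 \<longleftrightarrow> f = 0"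
proof
  assume "embed_Kinf f = 0"
  then have "Kinf_abs f = 0" by (simp flip: av_\<iota>)
  then show "f = 0" by (auto simp: Kinf_abs_def split: if_splits)
qed (simp only: embed_Kinf.zero)

lemma embed_Kinf_eq_iff: "embed_Kinf f = embed_Kinf h \<longleftrightarrow> f = h"
  using embed_Kinf_eq_0_iff[of "f - h"] unfolding embed_Kinf.diff by simp

lemma embed_Fq_eq_0_iff: "embed_Fq \<iota> a = 0 \<longleftrightarrow> a = 0"
  by (simp only: embed_Fq_def embed_Kinf_eq_0_iff fls_const_eq_0_iff)

lemma embed_Fq_power: "embed_Fq \<iota> (a ^ n) = embed_Fq \<iota> a ^ n"
  by (induction n) (simp_all add: embed_Fq_hom)

lemma embed_Fq_of_nat: "embed_Fq \<iota> (of_nat n) = of_nat n"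
  by (induction n) (simp_all add: embed_Fq_hom)

lemma embed_A_eq_embed_Kinf: "embed_A \<iota> a = embed_Kinf (eval_X_inv a)"
proof (induction a)
  case 0
  show ?case by (simp only: embed_A.zero eval_X_inv_0 embed_Kinf.zero)
next
  case (pCons c a)
  have "embed_A \<iota> (pCons c a) = embed_Fq \<iota> c + theta \<iota> * embed_A \<iota> a"
    by (simp add: embed_A_def map_poly_pCons embed_Fq_hom)
  then show ?case
    unfolding eval_X_inv_pCons embed_Kinf.add embed_Kinf_mult pCons.IH
    by (simp only: embed_Fq_def theta_def)
qed

lemma embed_A_eq_0_iff: "embed_A \<iota> a = 0 \<longleftrightarrow> a = 0"
  by (simp only: embed_A_eq_embed_Kinf embed_Kinf_eq_0_iff eval_X_inv_eq_0_iff)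

lemma theta_neq_0: "theta \<iota> \<noteq> 0"
  by (simp only: theta_def embed_Kinf_eq_0_iff) simp

lemma embed_Kinf_X: "embed_Kinf fls_X = 1 / theta \<iota>"
proof -
  have "embed_Kinf (fls_X * fls_X_inv) = 1" by (simp add: fls_X_times_conv_shift \<iota>_one)
  then show ?thesis
    unfolding embed_Kinf_mult using theta_neq_0 by (simp add: theta_def nonzero_eq_divide_eq)
qed

lemma av_embed_Kinf_fps_le: "av (embed_Kinf (fps_to_fls f)) \<le> 1"
proof -
  have "0 \<le> fls_subdegree (fps_to_fls f)" by (rule fls_subdegree_ge0I) simp
  then have "real CARD('k) powi (- fls_subdegree (fps_to_fls f)) \<le> 1"
    using CARD_gt_1[where ?'a = 'k] by (simp add: power_int_minus power_int_def field_simps)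
  then show ?thesis by (simp add: av_\<iota> Kinf_abs_def)
qed

lemma embed_Kinf_fps_expand:
  "embed_Kinf (fps_to_fls f) =
     (\<Sum>i<n. embed_Fq \<iota> (fps_nth f i) / theta \<iota> ^ i) +
     embed_Kinf (fps_to_fls (fps_shift n f)) / theta \<iota> ^ n"
proof (induction n)
  case (Suc n)
  let ?h = "fps_shift n f" and ?h' = "fps_shift (Suc n) f"
  have "?h = fps_const (fps_nth f n) + fps_X * ?h'"
    by (rule fps_ext) (auto simp: add.commute)
  then have "fps_to_fls ?h = fls_const (fps_nth f n) + fls_X * fps_to_fls ?h'"
    by (simp add: fls_times_fps_to_fls)
  then have "embed_Kinf (fps_to_fls ?h) =
      embed_Fq \<iota> (fps_nth f n) + embed_Kinf (fps_to_fls ?h') / theta \<iota>"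
    by (simp only: embed_Kinf.add embed_Kinf_mult embed_Kinf_X embed_Fq_def) simp
  with Suc.IH show ?case by (simp add: add_divide_distrib mult.commute)
qed simp

lemma embed_Kinf_fps_sums:
  "(\<lambda>i. embed_Fq \<iota> (fps_nth f i) / theta \<iota> ^ i) sums embed_Kinf (fps_to_fls f)"
  unfolding sums_def tendsto_av_iff
proof (rule Lim_null_comparison)
  let ?S = "\<lambda>n. \<Sum>i<n. embed_Fq \<iota> (fps_nth f i) / theta \<iota> ^ i"
  have "av (?S n - embed_Kinf (fps_to_fls f)) \<le> (1 / real CARD('k)) ^ n" for n
  proof -
    have "av (?S n - embed_Kinf (fps_to_fls f)) =
        av (embed_Kinf (fps_to_fls (fps_shift n f)) / theta \<iota> ^ n)"
      unfolding embed_Kinf_fps_expand[of f n]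
      by (subst av_minus_commute) (simp only: add_diff_cancel_left')
    then show ?thesis using av_embed_Kinf_fps_le
      by (simp add: av_divide av_power av_theta power_divide divide_right_mono)
  qed
  then show "\<forall>\<^sub>F n in sequentially.
      norm (av (?S n - embed_Kinf (fps_to_fls f))) \<le> (1 / real CARD('k)) ^ n"
    by simp
  show "(\<lambda>n. (1 / real CARD('k)) ^ n) \<longlonglongrightarrow> 0"
    using CARD_gt_1[where ?'a = 'k] by (intro LIMSEQ_realpow_zero) auto
qed

lemma embed_Kinf_functional_fls_sums:
  "(\<lambda>i. embed_Fq \<iota> (L (Polynomial.monom 1 i)) / theta \<iota> ^ (i + 1)) sums
     embed_Kinf (functional_fls L)"
  using sums_av_mult_left[OF embed_Kinf_fps_sums,
      of "1 / theta \<iota>" "Abs_fps (\<lambda>n. L (Polynomial.monom 1 n))"]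
  by (simp add: functional_fls_def embed_Kinf_mult embed_Kinf_X del: to_ac_mult)

lemma frobenius_add:
  fixes x y :: 'c
  shows "(x + y) ^ (CARD('k) ^ n) = x ^ (CARD('k) ^ n) + y ^ (CARD('k) ^ n)"
proof (rule freshmans_dream_CARD_power)
  show "of_nat CHAR('k) = (0 :: 'c)"
    using embed_Fq_of_nat[of "CHAR('k)"] by (simp add: embed_Fq_hom)
qed

sublocale frobenius: Modules.additive "\<lambda>x :: 'c. x ^ (CARD('k) ^ n)" for n
  by unfold_locales (rule frobenius_add)

lemma frobenius_embed_Fq: "embed_Fq \<iota> a ^ (CARD('k) ^ n) = embed_Fq \<iota> a"
  by (simp add: finite_field_power_card_power_eq_same flip: embed_Fq_power)

lemma sums_frobenius:
  fixes f :: "nat \<Rightarrow> 'c"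
  assumes "f sums s"
  shows "(\<lambda>i. f i ^ (CARD('k) ^ n)) sums (s ^ (CARD('k) ^ n))"
  using assms unfolding sums_def tendsto_av_iff
  by (auto simp: av_power simp flip: frobenius.sum frobenius.diff intro: tendsto_null_power)

section \<open>The exponential function\<close>

lemma av_theta_power_diff_ge:
  assumes "n > 0"
  shows "real CARD('k) ^ (CARD('k) ^ n) \<le> av (theta \<iota> ^ (CARD('k) ^ n) - theta \<iota>)"
proof -
  let ?Q = "CARD('k) ^ n"
  have "?Q > 1" using assms CARD_gt_1[where ?'a = 'k] by (intro one_less_power) auto
  then have "real CARD('k) ^ 1 < real CARD('k) ^ ?Q"
    using CARD_gt_1[where ?'a = 'k] by (intro power_strict_increasing) auto
  then show ?thesis
    using av_ultrametric[of "theta \<iota> ^ ?Q - theta \<iota>" "theta \<iota>"]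
    by (simp add: av_power av_theta max_def split: if_splits)
qed

lemma exp_coeff_root_recurrence:
  assumes "n > 0" "exp_coeff \<iota> r g n \<noteq> 0"
  obtains i where "i \<in> {1..min r n}"
    and "root (CARD('k) ^ n) (av (exp_coeff \<iota> r g n)) \<le>
      root (CARD('k) ^ n) (av (g i)) / real CARD('k) *
      root (CARD('k) ^ (n - i)) (av (exp_coeff \<iota> r g (n - i)))"
proof -
  let ?q = "CARD('k)" and ?e = "exp_coeff \<iota> r g"
  let ?S = "\<Sum>i\<in>{1..min r n}. g i * ?e (n - i) ^ (?q ^ i)"
  have e_n: "?e n = ?S / (theta \<iota> ^ (?q ^ n) - theta \<iota>)"
    using \<open>n > 0\<close> by (subst exp_coeff.simps) simp
  then have "{1..min r n} \<noteq> {}" using assms(2) by fastforce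
  then obtain i where i: "i \<in> {1..min r n}" and S: "av ?S \<le> av (g i * ?e (n - i) ^ (?q ^ i))"
    using av_sum_attained[of "{1..min r n}" "\<lambda>i. g i * ?e (n - i) ^ (?q ^ i)"] by blast
  have "av (?e n) \<le> av (g i * ?e (n - i) ^ (?q ^ i)) / real ?q ^ (?q ^ n)"
    unfolding e_n av_divide
    using S av_theta_power_diff_ge[OF \<open>n > 0\<close>] by (intro frac_le) simp_all
  then have "root (?q ^ n) (av (?e n)) \<le>
      root (?q ^ n) (av (g i * ?e (n - i) ^ (?q ^ i)) / real ?q ^ (?q ^ n))"
    by simp
  also have "\<dots> = root (?q ^ n) (av (g i)) / real ?q * root (?q ^ n) (av (?e (n - i)) ^ (?q ^ i))"
    by (simp add: real_root_divide real_root_mult real_root_power_cancel av_mult av_power)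
  also have "root (?q ^ n) (av (?e (n - i)) ^ (?q ^ i)) = root (?q ^ (n - i)) (av (?e (n - i)))"
  proof -
    have "?q ^ n = ?q ^ (n - i) * ?q ^ i" using i by (simp flip: power_add)
    then show ?thesis by (simp add: real_root_mult_exp real_root_power_cancel)
  qed
  finally show ?thesis using i that by blast
qed

lemma root_exp_coeff_tendsto_0:
  "(\<lambda>n. root (CARD('k) ^ n) (av (exp_coeff \<iota> r g n))) \<longlonglongrightarrow> 0"
proof -
  let ?q = "CARD('k)" and ?a = "\<lambda>n. root (CARD('k) ^ n) (av (exp_coeff \<iota> r g n))"
  define M where "M = 1 + (\<Sum>i=1..r. av (g i))"
  have "0 < M" unfolding M_def by (intro add_pos_nonneg sum_nonneg) auto
  have g_le: "av (g i) \<le> M" if "i \<in> {1..r}" for i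
    using member_le_sum[OF that, of "\<lambda>i. av (g i)"] by (simp add: M_def)
  have "strict_mono (\<lambda>n. ?q ^ n)"
    using CARD_gt_1[where ?'a = 'k] by (intro strict_monoI power_strict_increasing) auto
  with LIMSEQ_root_const[OF \<open>0 < M\<close>] have "(\<lambda>n. root (?q ^ n) M) \<longlonglongrightarrow> 1"
    using LIMSEQ_subseq_LIMSEQ by (fastforce simp: o_def)
  then have "\<forall>\<^sub>F n in sequentially. root (?q ^ n) M < 4 / 3" by (rule order_tendstoD) simp
  with eventually_gt_at_top[of 0]
  have "\<forall>\<^sub>F n in sequentially. ?a n = 0 \<or> (\<exists>i\<in>{1..min r n}. ?a n \<le> 2 / 3 * ?a (n - i))"
  proof eventually_elim
    case (elim n)
    show ?case
    proof (cases "exp_coeff \<iota> r g n = 0")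
      case False
      obtain i where i: "i \<in> {1..min r n}"
        and rec: "?a n \<le> root (?q ^ n) (av (g i)) / real ?q * ?a (n - i)"
        by (rule exp_coeff_root_recurrence[OF elim(1) False])
      have "root (?q ^ n) (av (g i)) \<le> root (?q ^ n) M" using g_le[of i] i by simp
      also have "\<dots> \<le> 4 / 3" using elim(2) by simp
      finally have "root (?q ^ n) (av (g i)) / real ?q \<le> (4 / 3) / 2"
        using CARD_gt_1[where ?'a = 'k] by (intro frac_le) auto
      then have "root (?q ^ n) (av (g i)) / real ?q * ?a (n - i) \<le> 2 / 3 * ?a (n - i)"
        by (intro mult_right_mono) auto
      with rec i show ?thesis using order_trans by blast
    qed simp
  qed
  then show ?thesis by (intro tendsto_0_if_contracting_recurrence[of ?a "2 / 3" r]) simp_all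
qed

lemma av_exp_term:
  "av (exp_coeff \<iota> r g n * x ^ (CARD('k) ^ n)) =
     (root (CARD('k) ^ n) (av (exp_coeff \<iota> r g n)) * av x) ^ (CARD('k) ^ n)"
  by (simp add: av_mult av_power power_mult_distrib)

lemma power_CARD_power_le_self:
  fixes u :: real
  assumes "0 \<le> u" "u \<le> 1"
  shows "u ^ (CARD('k) ^ n) \<le> u"
  using power_decreasing[of 1 "CARD('k) ^ n" u] assms by simp

lemma drinfeld_exp_sums:
  "(\<lambda>i. exp_coeff \<iota> r g i * x ^ (CARD('k) ^ i)) sums drinfeld_exp \<iota> r g x"
proof -
  let ?a = "\<lambda>n. root (CARD('k) ^ n) (av (exp_coeff \<iota> r g n)) * av x"
  have a: "?a \<longlonglongrightarrow> 0" by (intro tendsto_mult_left_zero root_exp_coeff_tendsto_0)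
  then have "\<forall>\<^sub>F n in sequentially. ?a n < 1" by (rule order_tendstoD) simp
  then have "\<forall>\<^sub>F n in sequentially. norm (av (exp_coeff \<iota> r g n * x ^ (CARD('k) ^ n))) \<le> ?a n"
  proof eventually_elim
    case (elim n)
    then show ?case unfolding av_exp_term using power_CARD_power_le_self[of "?a n" n] by simp
  qed
  then have "(\<lambda>n. av (exp_coeff \<iota> r g n * x ^ (CARD('k) ^ n))) \<longlonglongrightarrow> 0"
    using a by (rule Lim_null_comparison)
  then show ?thesis unfolding drinfeld_exp_def by (intro summable_sums summable_av)
qed

sublocale drinfeld_exp: Modules.additive "drinfeld_exp \<iota> r g" for r g
proof
  show "drinfeld_exp \<iota> r g (x + y) = drinfeld_exp \<iota> r g x + drinfeld_exp \<iota> r g y" for x y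
    using sums_av_add[OF drinfeld_exp_sums drinfeld_exp_sums, of r g x r g y]
    by (intro sums_unique2[OF drinfeld_exp_sums]) (simp add: frobenius_add distrib_left)
qed

lemma drinfeld_exp_embed_Fq:
  "drinfeld_exp \<iota> r g (embed_Fq \<iota> a * x) = embed_Fq \<iota> a * drinfeld_exp \<iota> r g x"
  using sums_av_mult_left[OF drinfeld_exp_sums, of "embed_Fq \<iota> a" r g x]
  by (intro sums_unique2[OF drinfeld_exp_sums])
     (simp add: power_mult_distrib frobenius_embed_Fq mult_ac)

lemma av_drinfeld_exp_le:
  obtains D where "0 < D"
    and "\<And>x. D * av x \<le> 1 \<Longrightarrow> av (drinfeld_exp \<iota> r g x) \<le> D * av x"
proof -
  let ?a = "\<lambda>n. root (CARD('k) ^ n) (av (exp_coeff \<iota> r g n))"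
  have "Bseq ?a"
    using root_exp_coeff_tendsto_0[of r g] by (intro convergent_imp_Bseq convergentI)
  then obtain D where "0 < D" and D: "norm (?a n) \<le> D" for n
    by (auto elim: BseqE)
  have "av (drinfeld_exp \<iota> r g x) \<le> D * av x" if "D * av x \<le> 1" for x
  proof (rule av_sums_le[OF drinfeld_exp_sums])
    fix n
    have "?a n * av x \<le> D * av x" using D[of n] by (intro mult_right_mono) auto
    then have "(?a n * av x) ^ (CARD('k) ^ n) \<le> (D * av x) ^ (CARD('k) ^ n)"
      by (intro power_mono) simp_all
    also have "\<dots> \<le> D * av x" using that \<open>0 < D\<close> by (intro power_CARD_power_le_self) simp_all
    finally show "av (exp_coeff \<iota> r g n * x ^ (CARD('k) ^ n)) \<le> D * av x"
      unfolding av_exp_term .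
  qed
  with \<open>0 < D\<close> show ?thesis by (rule that)
qed

lemma tendsto_drinfeld_exp:
  assumes "(f \<longlongrightarrow> s) F"
  shows "((\<lambda>n. drinfeld_exp \<iota> r g (f n)) \<longlongrightarrow> drinfeld_exp \<iota> r g s) F"
proof -
  obtain D where D: "\<And>x. D * av x \<le> 1 \<Longrightarrow> av (drinfeld_exp \<iota> r g x) \<le> D * av x"
    using av_drinfeld_exp_le[where r = r and g = g] by blast
  have small: "((\<lambda>n. D * av (f n - s)) \<longlongrightarrow> 0) F"
    using assms unfolding tendsto_av_iff by (rule tendsto_mult_right_zero)
  then have "\<forall>\<^sub>F n in F. D * av (f n - s) < 1" by (rule order_tendstoD) simp
  then have "\<forall>\<^sub>F n in F.
      norm (av (drinfeld_exp \<iota> r g (f n) - drinfeld_exp \<iota> r g s)) \<le> D * av (f n - s)"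
    by eventually_elim (simp add: D flip: drinfeld_exp.diff)
  then show ?thesis unfolding tendsto_av_iff using small by (rule Lim_null_comparison)
qed

lemma sums_drinfeld_exp:
  "f sums s \<Longrightarrow> (\<lambda>i. drinfeld_exp \<iota> r g (f i)) sums drinfeld_exp \<iota> r g s"
  unfolding sums_def by (simp add: tendsto_drinfeld_exp flip: drinfeld_exp.sum)

lemma sums_frobenius_shift:
  fixes f :: "nat \<Rightarrow> 'c"
  assumes "f sums s"
  shows "(\<lambda>n. if i \<le> n then c * f (n - i) ^ (CARD('k) ^ i) else 0) sums (c * s ^ (CARD('k) ^ i))"
    (is "?S sums _")
proof -
  have "(\<lambda>n. ?S (n + i)) sums (c * s ^ (CARD('k) ^ i))"
    using assms by (simp add: sums_av_mult_left sums_frobenius)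
  then show ?thesis by (subst (asm) sums_shift_iff_if_zero) simp_all
qed

lemma drinfeld_exp_theta:
  "drinfeld_exp \<iota> r g (theta \<iota> * x) = phi_theta \<iota> r g (drinfeld_exp \<iota> r g x)"
proof -
  let ?q = "CARD('k)" and ?e = "exp_coeff \<iota> r g"
  define T where "T = (\<lambda>n. ?e n * x ^ (?q ^ n))"
  define S where "S = (\<lambda>i n. if i \<le> n then g i * T (n - i) ^ (?q ^ i) else 0)"
  have T: "T sums drinfeld_exp \<iota> r g x" unfolding T_def by (rule drinfeld_exp_sums)
  have S: "S i sums (g i * drinfeld_exp \<iota> r g x ^ (?q ^ i))" for i
    unfolding S_def by (rule sums_frobenius_shift[OF T])
  have "?e n * (theta \<iota> * x) ^ (?q ^ n) = theta \<iota> * T n + (\<Sum>i=1..r. S i n)" for n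
  proof -
    have "?e n * theta \<iota> ^ (?q ^ n) =
        theta \<iota> * ?e n + (\<Sum>i=1..min r n. g i * ?e (n - i) ^ (?q ^ i))"
      using exp_coeff_unique[where e = ?e and r = r and g = g] by blast
    then have "?e n * (theta \<iota> * x) ^ (?q ^ n) =
        theta \<iota> * T n + (\<Sum>i=1..min r n. g i * ?e (n - i) ^ (?q ^ i)) * x ^ (?q ^ n)"
      by (simp add: T_def power_mult_distrib distrib_right flip: mult.assoc)
    also have "(\<Sum>i=1..min r n. g i * ?e (n - i) ^ (?q ^ i)) * x ^ (?q ^ n) = (\<Sum>i=1..min r n. S i n)"
      unfolding sum_distrib_right
      by (intro sum.cong)
         (auto simp: S_def T_def power_mult_distrib simp flip: power_mult power_add)
    also have "\<dots> = (\<Sum>i=1..r. S i n)"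
      by (intro sum.mono_neutral_left) (auto simp: S_def)
    finally show ?thesis .
  qed
  moreover have "(\<lambda>n. theta \<iota> * T n + (\<Sum>i=1..r. S i n)) sums phi_theta \<iota> r g (drinfeld_exp \<iota> r g x)"
    unfolding phi_theta_def by (intro sums_av_add sums_av_sum sums_av_mult_left S T)
  ultimately show ?thesis using sums_unique2[OF drinfeld_exp_sums] by simp
qed

section \<open>Torsion points as values of the exponential\<close>

lemma map_poly_embed_add:
  "map_poly (embed_Fq \<iota>) (f + h) = map_poly (embed_Fq \<iota>) f + map_poly (embed_Fq \<iota>) h"
  by (rule map_poly_add) (rule embed_Fq.additive_axioms)

lemma map_poly_embed_mult:
  "map_poly (embed_Fq \<iota>) (f * h) = map_poly (embed_Fq \<iota>) f * map_poly (embed_Fq \<iota>) h"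
  by (rule map_poly_mult) (rule embed_Fq.additive_axioms embed_Fq_hom)+

lemma poly_map_poly_embed:
  assumes "degree f < n"
  shows "poly (map_poly (embed_Fq \<iota>) f) x = (\<Sum>i<n. embed_Fq \<iota> (poly.coeff f i) * x ^ i)"
proof -
  have "degree (map_poly (embed_Fq \<iota>) f) = degree f"
    by (rule degree_map_poly) (simp add: embed_Fq_eq_0_iff)
  then have "poly (map_poly (embed_Fq \<iota>) f) x =
      (\<Sum>i\<le>degree f. embed_Fq \<iota> (poly.coeff f i) * x ^ i)"
    by (simp add: poly_altdef coeff_map_poly embed_Fq_hom)
  also have "\<dots> = (\<Sum>i<n. embed_Fq \<iota> (poly.coeff f i) * x ^ i)"
    using assms by (intro sum.mono_neutral_left) (auto simp: coeff_eq_0 embed_Fq_hom)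
  finally show ?thesis .
qed

lemma poly_pderiv_map_poly_embed_neq_0:
  assumes "irreducible p" "poly (map_poly (embed_Fq \<iota>) p) x = 0"
  shows "poly (pderiv (map_poly (embed_Fq \<iota>) p)) x \<noteq> 0"
proof -
  obtain u v where "u * p + v * pderiv p = 1" by (rule irreducible_bezout_pderiv[OF assms(1)])
  then have "poly (map_poly (embed_Fq \<iota>) (u * p + v * pderiv p)) x = 1"
    by (simp add: embed_Fq_hom)
  moreover have "map_poly (embed_Fq \<iota>) (pderiv p) = pderiv (map_poly (embed_Fq \<iota>) p)"
    by (rule poly_eqI)
       (simp add: coeff_pderiv coeff_map_poly embed_Fq_hom embed_Fq_of_nat del: of_nat_Suc)
  ultimately show ?thesis
    unfolding map_poly_embed_add map_poly_embed_mult using assms(2) by auto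
qed

lemma poly_map_poly_embed_hasse:
  assumes "irreducible p" "poly (map_poly (embed_Fq \<iota>) p) x = 0"
  shows "poly (map_poly (embed_Fq \<iota>) (hasse m f)) x =
    (\<Sum>l<degree p. embed_Fq \<iota> (hasse_functional p m l f) * x ^ l)"
proof -
  have "poly (map_poly (embed_Fq \<iota>) (hasse m f)) x =
      poly (map_poly (embed_Fq \<iota>) (hasse m f div p * p + hasse m f mod p)) x" by simp
  also have "\<dots> = poly (map_poly (embed_Fq \<iota>) (hasse m f mod p)) x"
    unfolding map_poly_embed_add map_poly_embed_mult using assms(2) by simp
  also have "\<dots> = (\<Sum>l<degree p. embed_Fq \<iota> (hasse_functional p m l f) * x ^ l)"
    unfolding hasse_functional_def
    by (rule poly_map_poly_embed[OF degree_mod_less_irreducible[OF assms(1)]])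
  finally show ?thesis .
qed

abbreviation functional_exp :: "nat \<Rightarrow> (nat \<Rightarrow> 'c) \<Rightarrow> 'c \<Rightarrow> ('k poly \<Rightarrow> 'k) \<Rightarrow> 'c" where
  "functional_exp r g z L \<equiv> drinfeld_exp \<iota> r g (z * embed_Kinf (functional_fls L))"

lemma functional_exp_sums:
  "(\<lambda>i. embed_Fq \<iota> (L (Polynomial.monom 1 i)) * drinfeld_exp \<iota> r g (z / theta \<iota> ^ (i + 1)))
    sums functional_exp r g z L"
proof -
  have "z * (embed_Fq \<iota> a / u) = embed_Fq \<iota> a * (z / u)" for a u by simp
  then show ?thesis
    using sums_drinfeld_exp[OF sums_av_mult_left[OF embed_Kinf_functional_fls_sums], of r g z L]
    by (simp only: drinfeld_exp_embed_Fq)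
qed

lemma tate_eval_hyperderiv_anderson_gen:
  assumes "irreducible p" "poly (map_poly (embed_Fq \<iota>) p) x = 0"
  shows "tate_eval (hyperderiv m (anderson_gen \<iota> r g z)) x =
    (\<Sum>l<degree p. functional_exp r g z (hasse_functional p m l) * x ^ l)"
    (is "_ = ?value")
proof -
  let ?E = "\<lambda>i. drinfeld_exp \<iota> r g (z / theta \<iota> ^ (i + 1))"
  define term_of where
    "term_of i = poly (map_poly (embed_Fq \<iota>) (hasse m (Polynomial.monom 1 i))) x * ?E i" for i
  have "(\<lambda>i. \<Sum>l<degree p. x ^ l *
      (embed_Fq \<iota> (hasse_functional p m l (Polynomial.monom 1 i)) * ?E i)) sums
      (\<Sum>l<degree p. x ^ l *
        functional_exp r g z (hasse_functional p m l))"
    by (intro sums_av_sum sums_av_mult_left functional_exp_sums)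
  then have "term_of sums ?value"
    unfolding term_of_def poly_map_poly_embed_hasse[OF assms]
    by (simp add: sum_distrib_left sum_distrib_right mult_ac)
  moreover have term_of: "term_of i = of_nat (i choose m) * x ^ (i - m) * ?E i" for i
    by (simp add: term_of_def hasse_monom smult_monom map_poly_monom poly_monom embed_Fq_of_nat
        embed_Fq_hom)
  ultimately have "(\<lambda>i. term_of (i + m)) sums ?value"
    by (subst sums_shift_iff_if_zero) (simp_all add: binomial_eq_0)
  then show ?thesis
    by (simp add: tate_eval_def hyperderiv_def anderson_gen_def term_of sums_iff mult_ac)
qed

lemma phi_theta_iterate_drinfeld_exp:
  "(phi_theta \<iota> r g ^^ i) (drinfeld_exp \<iota> r g x) = drinfeld_exp \<iota> r g (theta \<iota> ^ i * x)"
  by (induction i) (simp_all add: mult.assoc flip: drinfeld_exp_theta)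

lemma phi_drinfeld_exp:
  "phi \<iota> r g a (drinfeld_exp \<iota> r g x) = drinfeld_exp \<iota> r g (embed_A \<iota> a * x)"
proof -
  have "embed_A \<iota> a * x = (\<Sum>i\<le>degree a. embed_Fq \<iota> (poly.coeff a i) * (theta \<iota> ^ i * x))"
    unfolding embed_A_def using poly_map_poly_embed[of a "Suc (degree a)" "theta \<iota>"]
    by (simp add: sum_distrib_left mult_ac lessThan_Suc_atMost)
  then show ?thesis
    by (simp add: phi_def phi_theta_iterate_drinfeld_exp drinfeld_exp.sum drinfeld_exp_embed_Fq)
qed

lemma drinfeld_exp_mem_torsion_iff:
  "drinfeld_exp \<iota> r g x \<in> torsion \<iota> r g a \<longleftrightarrow> embed_A \<iota> a * x \<in> period_lattice \<iota> r g"
  by (simp add: torsion_def period_lattice_def phi_drinfeld_exp)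

lemma period_lattice_sum_A_scale:
  assumes "\<And>j. j \<in> J \<Longrightarrow> z j \<in> period_lattice \<iota> r g"
  shows "(\<Sum>j\<in>J. A_scale \<iota> (a j) (z j)) \<in> period_lattice \<iota> r g"
proof -
  have "phi \<iota> r g b 0 = 0" for b
    using phi_drinfeld_exp[of r g b 0] by (simp add: drinfeld_exp.zero)
  then have "drinfeld_exp \<iota> r g (A_scale \<iota> (a j) (z j)) = 0" if "j \<in> J" for j
    using assms[OF that] by (simp add: period_lattice_def A_scale_def flip: phi_drinfeld_exp)
  then show ?thesis by (simp add: period_lattice_def drinfeld_exp.sum)
qed

definition functional_point :: "'i set \<Rightarrow> ('i \<Rightarrow> 'c) \<Rightarrow> ('i \<Rightarrow> 'k poly \<Rightarrow> 'k) \<Rightarrow> 'c" where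
  "functional_point J z L = (\<Sum>j\<in>J. z j * embed_Kinf (functional_fls (L j)))"

lemma drinfeld_exp_functional_point_lincomb:
  "drinfeld_exp \<iota> r g (functional_point J z (\<lambda>j f. \<Sum>i\<in>I. a (j, i) * L i f)) =
    (\<Sum>(j, i)\<in>J \<times> I. Fq_scale \<iota> (a (j, i))
      (functional_exp r g (z j) (L i)))"
proof -
  have "functional_point J z (\<lambda>j f. \<Sum>i\<in>I. a (j, i) * L i f) =
      (\<Sum>j\<in>J. \<Sum>i\<in>I. embed_Fq \<iota> (a (j, i)) * (z j * embed_Kinf (functional_fls (L i))))"
    unfolding functional_point_def functional_fls_lincomb embed_Kinf.sum embed_Kinf_mult
    by (simp add: sum_distrib_left embed_Fq_def mult.left_commute)
  then show ?thesis
    by (simp only: drinfeld_exp.sum drinfeld_exp_embed_Fq Fq_scale_def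
        sum.cartesian_product[symmetric])
qed

lemma functional_point_denominator:
  assumes "\<And>j. j \<in> J \<Longrightarrow> poly_functional (L j)" "\<And>j f. j \<in> J \<Longrightarrow> L j (P * f) = 0"
  obtains Q where "\<And>j. j \<in> J \<Longrightarrow> eval_X_inv P * functional_fls (L j) = eval_X_inv (Q j)"
    and "embed_A \<iota> P * functional_point J z L = (\<Sum>j\<in>J. A_scale \<iota> (Q j) (z j))"
proof -
  have "\<forall>j\<in>J. \<exists>Q. eval_X_inv P * functional_fls (L j) = eval_X_inv Q"
    using functional_fls_denominator assms by metis
  then obtain Q where Q: "eval_X_inv P * functional_fls (L j) = eval_X_inv (Q j)" if "j \<in> J" for j
    by metis
  have "embed_A \<iota> P * (z j * embed_Kinf (functional_fls (L j))) = A_scale \<iota> (Q j) (z j)"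
    if "j \<in> J" for j
    using Q[OF that] by (simp add: A_scale_def embed_A_eq_embed_Kinf flip: embed_Kinf_mult)
  then have "embed_A \<iota> P * functional_point J z L = (\<Sum>j\<in>J. A_scale \<iota> (Q j) (z j))"
    by (simp add: functional_point_def sum_distrib_left)
  with Q show ?thesis by (rule that)
qed

lemma drinfeld_exp_functional_point_mem_torsion:
  assumes "\<And>j. j \<in> J \<Longrightarrow> z j \<in> period_lattice \<iota> r g"
    and "\<And>j. j \<in> J \<Longrightarrow> poly_functional (L j)" "\<And>j f. j \<in> J \<Longrightarrow> L j (P * f) = 0"
  shows "drinfeld_exp \<iota> r g (functional_point J z L) \<in> torsion \<iota> r g P"
proof -
  obtain Q where "embed_A \<iota> P * functional_point J z L = (\<Sum>j\<in>J. A_scale \<iota> (Q j) (z j))"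
    using functional_point_denominator[of J L P z] assms(2,3) by metis
  then show ?thesis
    using period_lattice_sum_A_scale[OF assms(1)] by (simp add: drinfeld_exp_mem_torsion_iff)
qed

lemma functional_eq_0_if_drinfeld_exp_functional_point_eq_0:
  assumes basis: "basis_family (A_scale \<iota>) J z (period_lattice \<iota> r g)" and "finite J" "P \<noteq> 0"
    and L: "\<And>j. j \<in> J \<Longrightarrow> poly_functional (L j)" "\<And>j f. j \<in> J \<Longrightarrow> L j (P * f) = 0"
    and zero: "drinfeld_exp \<iota> r g (functional_point J z L) = 0"
    and "j \<in> J"
  shows "L j f = 0"
proof -
  obtain Q where Q: "\<And>j. j \<in> J \<Longrightarrow> eval_X_inv P * functional_fls (L j) = eval_X_inv (Q j)"
    and P_point: "embed_A \<iota> P * functional_point J z L = (\<Sum>j\<in>J. A_scale \<iota> (Q j) (z j))"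
    using functional_point_denominator[of J L P z] L by metis
  have "functional_point J z L \<in> period_lattice \<iota> r g" using zero by (simp add: period_lattice_def)
  then obtain \<alpha> where \<alpha>: "functional_point J z L = (\<Sum>j\<in>J. A_scale \<iota> (\<alpha> j) (z j))"
    using basis_family_expand[OF module_A_scale basis \<open>finite J\<close>] by blast
  have "(\<Sum>j\<in>J. A_scale \<iota> (Q j) (z j)) = (\<Sum>j\<in>J. A_scale \<iota> (P * \<alpha> j) (z j))"
    unfolding P_point[symmetric] \<alpha>
    by (simp add: A_scale_def embed_A_hom sum_distrib_left mult.assoc)
  then have "Q j = P * \<alpha> j"
    by (rule basis_family_coeff_unique[OF module_A_scale basis \<open>finite J\<close> _ \<open>j \<in> J\<close>])
  then have "embed_A \<iota> P * embed_Kinf (functional_fls (L j)) = embed_A \<iota> P * embed_A \<iota> (\<alpha> j)"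
    using Q[OF \<open>j \<in> J\<close>] embed_A_hom(3) embed_A_eq_embed_Kinf embed_Kinf_mult by metis
  then have "functional_fls (L j) = eval_X_inv (\<alpha> j)"
    using \<open>P \<noteq> 0\<close>
    by (simp add: embed_A_eq_0_iff) (simp add: embed_A_eq_embed_Kinf embed_Kinf_eq_iff)
  then show ?thesis by (rule functional_eq_0_if_fls_polynomial[OF L(1)[OF \<open>j \<in> J\<close>]])
qed

section \<open>The number of torsion points\<close>

definition phi_theta_poly :: "nat \<Rightarrow> (nat \<Rightarrow> 'c) \<Rightarrow> 'c poly" where
  "phi_theta_poly r g =
     Polynomial.monom (theta \<iota>) 1 + (\<Sum>i=1..r. Polynomial.monom (g i) (CARD('k) ^ i))"

definition phi_poly :: "nat \<Rightarrow> (nat \<Rightarrow> 'c) \<Rightarrow> 'k poly \<Rightarrow> 'c poly" where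
  "phi_poly r g a = (\<Sum>i\<le>degree a. smult (embed_Fq \<iota> (poly.coeff a i))
     ((pcompose (phi_theta_poly r g) ^^ i) [:0, 1:]))"

lemma poly_phi_poly: "poly (phi_poly r g a) x = phi \<iota> r g a x"
proof -
  have "poly (phi_theta_poly r g) y = phi_theta \<iota> r g y" for y
    by (simp add: phi_theta_poly_def phi_theta_def poly_monom poly_sum)
  then have "poly ((pcompose (phi_theta_poly r g) ^^ i) [:0, 1:]) x =
      (phi_theta \<iota> r g ^^ i) x" for i
    by (induction i) (simp_all add: poly_pcompose)
  then show ?thesis by (simp add: phi_poly_def phi_def poly_sum)
qed

lemma degree_phi_theta_poly:
  assumes "1 \<le> r" "g r \<noteq> 0"
  shows "degree (phi_theta_poly r g) = CARD('k) ^ r"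
proof (rule antisym)
  have one_less: "1 < CARD('k) ^ r"
    using CARD_gt_1[where ?'a = 'k] assms(1) by (intro one_less_power) auto
  have "degree (Polynomial.monom (g i) (CARD('k) ^ i)) \<le> CARD('k) ^ r" if "i \<in> {1..r}" for i
    using that by (intro order_trans[OF degree_monom_le] power_increasing) auto
  moreover have "degree (Polynomial.monom (theta \<iota>) 1) \<le> CARD('k) ^ r"
    by (intro order_trans[OF degree_monom_le]) simp
  ultimately show "degree (phi_theta_poly r g) \<le> CARD('k) ^ r"
    unfolding phi_theta_poly_def by (intro degree_add_le degree_sum_le) auto
  have "poly.coeff (phi_theta_poly r g) (CARD('k) ^ r) = (\<Sum>i=1..r. if i = r then g i else 0)"
    using CARD_gt_1[where ?'a = 'k] one_less
    by (auto simp: phi_theta_poly_def coeff_sum intro!: sum.cong)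
  also have "\<dots> \<noteq> 0" using assms by simp
  finally show "CARD('k) ^ r \<le> degree (phi_theta_poly r g)" by (rule le_degree)
qed

lemma degree_phi_poly:
  assumes "1 \<le> r" "g r \<noteq> 0" "a \<noteq> 0"
  shows "degree (phi_poly r g a) = CARD('k) ^ (r * degree a)"
proof -
  let ?iterate = "\<lambda>i. (pcompose (phi_theta_poly r g) ^^ i) [:0, 1:]"
  let ?term = "\<lambda>i. smult (embed_Fq \<iota> (poly.coeff a i)) (?iterate i)"
  have iterate: "degree (?iterate i) = CARD('k) ^ (r * i)" for i
    using degree_phi_theta_poly[where g = g, OF assms(1,2)]
    by (induction i) (simp_all add: degree_pcompose power_add)
  have "degree (\<Sum>i<degree a. ?term i) < CARD('k) ^ (r * degree a)"
  proof (rule degree_sum_less)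
    fix i assume "i \<in> {..<degree a}"
    then have "CARD('k) ^ (r * i) < CARD('k) ^ (r * degree a)"
      using CARD_gt_1[where ?'a = 'k] assms(1) by (intro power_strict_increasing) auto
    then show "degree (?term i) < CARD('k) ^ (r * degree a)"
      by (intro le_less_trans[OF degree_smult_le]) (simp add: iterate)
  qed simp
  moreover have "degree (?term (degree a)) = CARD('k) ^ (r * degree a)"
    using assms(3) by (simp add: iterate embed_Fq_eq_0_iff)
  moreover have "phi_poly r g a = (\<Sum>i<degree a. ?term i) + ?term (degree a)"
    unfolding phi_poly_def by (simp flip: lessThan_Suc_atMost)
  ultimately show ?thesis by (simp only: degree_add_eq_right)
qed

lemma torsion_card_le:
  assumes "1 \<le> r" "g r \<noteq> 0" "a \<noteq> 0"
  shows "finite (torsion \<iota> r g a)" "card (torsion \<iota> r g a) \<le> CARD('k) ^ (r * degree a)"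
proof -
  note degree = degree_phi_poly[where g = g, OF assms]
  then have "phi_poly r g a \<noteq> 0" by auto
  moreover have "torsion \<iota> r g a = {x. poly (phi_poly r g a) x = 0}"
    by (simp add: torsion_def poly_phi_poly)
  ultimately show "finite (torsion \<iota> r g a)" "card (torsion \<iota> r g a) \<le> CARD('k) ^ (r * degree a)"
    using poly_roots_finite card_poly_roots_bound degree by metis+
qed

section \<open>Bases of the torsion\<close>

lemma basis_family_torsion_functionals:
  assumes r: "1 \<le> r" "g r \<noteq> 0" and "P \<noteq> 0"
    and basis: "basis_family (A_scale \<iota>) {1..r} z (period_lattice \<iota> r g)"
    and I: "finite I" "card I = degree P"
    and L: "\<And>i. i \<in> I \<Longrightarrow> poly_functional (L i)" "\<And>i f. i \<in> I \<Longrightarrow> L i (P * f) = 0"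
    and indep: "\<And>a i. (\<And>f. (\<Sum>i\<in>I. a i * L i f) = 0) \<Longrightarrow> i \<in> I \<Longrightarrow> a i = 0"
  shows "basis_family (Fq_scale \<iota>) ({1..r} \<times> I)
    (\<lambda>(j, i). functional_exp r g (z j) (L i)) (torsion \<iota> r g P)"
proof (rule basis_familyI_card[OF vector_space_Fq_scale])
  let ?b = "\<lambda>(j, i). functional_exp r g (z j) (L i)"
  let ?L = "\<lambda>a (j :: nat) f. \<Sum>i\<in>I. a (j, i) * L i f"
  have functional: "poly_functional (?L a j)" for a j using L(1) by (rule poly_functional_lincomb)
  have vanish: "?L a j (P * f) = 0" for a j f by (simp add: L(2))
  have lincomb: "(\<Sum>ji\<in>{1..r} \<times> I. Fq_scale \<iota> (a ji) (?b ji)) =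
      drinfeld_exp \<iota> r g (functional_point {1..r} z (?L a))" for a
    unfolding drinfeld_exp_functional_point_lincomb by (rule sum.cong) auto
  show "finite ({1..r} \<times> I)" using I by simp
  show "finite (torsion \<iota> r g P)" by (rule torsion_card_le(1)[where g = g, OF r \<open>P \<noteq> 0\<close>])
  show "card (torsion \<iota> r g P) \<le> CARD('k) ^ card ({1..r} \<times> I)"
    using torsion_card_le(2)[where g = g, OF r \<open>P \<noteq> 0\<close>] I by (simp add: card_cartesian_product)
  show "(\<Sum>ji\<in>{1..r} \<times> I. Fq_scale \<iota> (a ji) (?b ji)) \<in> torsion \<iota> r g P" for a
    unfolding lincomb
    by (rule drinfeld_exp_functional_point_mem_torsion)
       (auto intro: basis_family_mem[OF module_A_scale basis] functional simp: vanish)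
  fix a ji
  assume zero: "(\<Sum>ji\<in>{1..r} \<times> I. Fq_scale \<iota> (a ji) (?b ji)) = 0" and "ji \<in> {1..r} \<times> I"
  then obtain j i where ji: "ji = (j, i)" "j \<in> {1..r}" "i \<in> I" by auto
  have "?L a j f = 0" for f
    using functional_eq_0_if_drinfeld_exp_functional_point_eq_0[OF basis _ \<open>P \<noteq> 0\<close>, of "?L a"]
      functional vanish zero ji(2) unfolding lincomb by blast
  then show "a ji = 0" using indep[of "\<lambda>i. a (j, i)"] ji by blast
qed

lemma basis_family_torsion_power:
  assumes "1 \<le> r" "g r \<noteq> 0" and "irreducible p"
    and "basis_family (A_scale \<iota>) {1..r} z (period_lattice \<iota> r g)"
  shows "basis_family (Fq_scale \<iota>) ({1..r} \<times> {0..n} \<times> {0..<degree p})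
    (\<lambda>(j, m, l). functional_exp r g (z j) (hasse_functional p m l))
    (torsion \<iota> r g (p ^ (n + 1)))"
proof -
  let ?I = "{0..n} \<times> {0..<degree p}" and ?L = "\<lambda>(m, l). hasse_functional p m l"
  have "p \<noteq> 0" using assms(3) by auto
  have "basis_family (Fq_scale \<iota>) ({1..r} \<times> ?I)
    (\<lambda>(j, i). functional_exp r g (z j) (?L i))
    (torsion \<iota> r g (p ^ (n + 1)))"
  proof (rule basis_family_torsion_functionals[OF assms(1,2) _ assms(4)])
    show "card ?I = degree (p ^ (n + 1))"
      using \<open>p \<noteq> 0\<close> by (simp add: degree_power_eq card_cartesian_product del: power_Suc)
    show "poly_functional (?L i)" for i by (simp add: split_beta poly_functional_hasse)
    show "?L i (p ^ (n + 1) * f) = 0" if "i \<in> ?I" for i f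
      using that hasse_functional_eq_0[of p n "p ^ (n + 1) * f"] by auto
    show "a i = 0" if "\<And>f. (\<Sum>i\<in>?I. a i * ?L i f) = 0" "i \<in> ?I" for a i
      using hasse_functionals_independent[OF assms(3), of "\<lambda>m l. a (m, l)" n "fst i" "snd i"] that
      by (simp add: split_beta atLeast0AtMost atLeast0LessThan mem_Times_iff)
  qed (use \<open>p \<noteq> 0\<close> in simp_all)
  then show ?thesis by (rule basis_family_cong[THEN iffD1, rotated]) auto
qed

end

theorem theorem3p5:
  fixes \<iota> :: "'k::finite_field fls alg_closure \<Rightarrow> 'c::{field, complete_space}"
    and av :: "'c \<Rightarrow> real"
    and F :: "'c set"
    and r :: nat
    and g :: "nat \<Rightarrow> 'c"
    and z :: "nat \<Rightarrow> 'c"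
    and \<pp> :: "'k poly"
    and \<zeta> :: "nat \<Rightarrow> 'c"
    and c :: "nat \<Rightarrow> nat \<Rightarrow> nat \<Rightarrow> 'c"
  assumes "C_infinity \<iota> av"
    and "subfield F ring_of_type_algebra"
    and "K_set \<iota> \<subseteq> F"
    and "drinfeld_module F r g"
    and "basis_family (A_scale \<iota>) {1..r} z (period_lattice \<iota> r g)"
    and "lead_coeff \<pp> = 1"
    and "irreducible \<pp>"
    and "map_poly (embed_Fq \<iota>) \<pp> = (\<Prod>k=1..degree \<pp>. [:- \<zeta> k, 1:])"
    and "\<And>j m k. j \<in> {1..r} \<Longrightarrow> k \<in> {1..degree \<pp>} \<Longrightarrow>
           tate_eval (hyperderiv m (anderson_gen \<iota> r g (z j))) (\<zeta> k)
             = (\<Sum>l<degree \<pp>. c j m l * \<zeta> k ^ l)"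
  shows "\<forall>n. basis_family (Fq_scale \<iota>) ({1..r} \<times> {0..n} \<times> {0..<degree \<pp>})
           (\<lambda>(j, m, l). c j m l) (torsion \<iota> r g (\<pp> ^ (n + 1)))"
proof
  fix n
  interpret C_infinity \<iota> av by fact
  have r: "1 \<le> r" "g r \<noteq> 0" using assms(4) by (auto simp: drinfeld_module_def)
  have root: "poly (map_poly (embed_Fq \<iota>) \<pp>) (\<zeta> k) = 0" if "k \<in> {1..degree \<pp>}" for k
    unfolding assms(8) poly_prod using that by (intro prod_zero) auto
  have inj: "inj_on \<zeta> {1..degree \<pp>}"
    using poly_pderiv_map_poly_embed_neq_0[OF assms(7) root]
    unfolding assms(8) by (intro inj_on_roots_if_pderiv_nonzero) simp_all
  let ?value = "\<lambda>j m l. functional_exp r g (z j) (hasse_functional \<pp> m l)"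
  have "(\<Sum>l<degree \<pp>. c j m l * \<zeta> k ^ l) = (\<Sum>l<degree \<pp>. ?value j m l * \<zeta> k ^ l)"
    if "j \<in> {1..r}" "k \<in> {1..degree \<pp>}" for j m k
    unfolding assms(9)[OF that, symmetric]
    by (rule tate_eval_hyperderiv_anderson_gen[OF assms(7) root[OF that(2)]])
  then have c_eq: "c j m l = ?value j m l" if "j \<in> {1..r}" "l < degree \<pp>" for j m l
    using that
    by (intro coeff_eq_if_power_sums_eq[OF inj, of "degree \<pp>" "c j m" "?value j m"]) simp_all
  show "basis_family (Fq_scale \<iota>) ({1..r} \<times> {0..n} \<times> {0..<degree \<pp>})
      (\<lambda>(j, m, l). c j m l) (torsion \<iota> r g (\<pp> ^ (n + 1)))"
    using basis_family_torsion_power[OF r assms(7,5), of n]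
    by (subst basis_family_cong[where b' = "\<lambda>(j, m, l). ?value j m l"]) (auto simp: c_eq)
qed

end
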